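(* Let $m\in\mathbb{N}$. For any centered Gaussian random vector $(X_1,X_2,X_3,X_4)$ (each $X_i$ real-valued with positive variance), $$E[X_1^{2m}X_2^{2}X_3^{2}X_4^{2}]\ge E[X_1^{2m}]\,E[X_2^{2}]\,E[X_3^{2}]\,E[X_4^{2}],$$ and equality holds if and only if $X_1,X_2,X_3,X_4$ are independent.
   Context: All Gaussian random variables are assumed real-valued and non-degenerate (positive variance). $\mathbb{N}=\{1,2,3,\dots\}$. *)

theory Defs
  imports "HOL-Probability.Probability"
begin

definition centered_gaussian_vector ::
  "'a measure \<Rightarrow> nat set \<Rightarrow> (nat \<Rightarrow> 'a \<Rightarrow> real) \<Rightarrow> bool" where
  "centered_gaussian_vector M I X \<longleftrightarrow>
     prob_space M \<and> finite I \<and>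
     (\<forall>i\<in>I. X i \<in> borel_measurable M) \<and>
     (\<forall>a :: nat \<Rightarrow> real.
        (AE x in M. (\<Sum>i\<in>I. a i * X i x) = 0) \<or>
        (\<exists>\<sigma>>0. distributed M lborel (\<lambda>x. \<Sum>i\<in>I. a i * X i x) (normal_density 0 \<sigma>)))"

end

theory Submission
  imports Defs
begin

text \<open>
  Write \<open>q = 2m + 1\<close> and consider the measure with density proportional to \<open>X\<^sub>1\<^sup>2\<^sup>m\<close>. In its
  orthogonal decomposition by degree (Hermite polynomials in the variables independent of \<open>X\<^sub>1\<close>,
  generalized Hermite polynomials for the weight \<open>t\<^sup>2\<^sup>m\<close> in \<open>X\<^sub>1\<close>), the squared norm of the
  degree-3 component of \<open>X\<^sub>2 X\<^sub>3 X\<^sub>4\<close> is at least its value for \<open>m = 0\<close>, which is the permanent of the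
  covariance matrix of \<open>(X\<^sub>2, X\<^sub>3, X\<^sub>4)\<close>; and this permanent is at least the product of the
  diagonal entries. Made explicit, this is a decomposition of the difference of both sides into
  nonnegative terms, all of which vanish only if all covariances do.
\<close>

text \<open>The constant \<open>q\<close> is the second moment of the normalized first variable
  under its own weight; the fourth and sixth are \<open>q * (q + 2)\<close> and
  \<open>q * (q + 2) * (q + 4)\<close>. The whole moment is therefore a polynomial in
  \<open>q\<close> and the covariances. The orthogonal polynomials guide the proof but are never
  constructed: only the identity they produce is stated and checked by ring arithmetic. The mixed
  moment itself is not expanded over pairings. Polarization writes it as a combination of moments of
  one sixth power against an even power of the first variable, so splitting a single Gaussian into a
  multiple of the first variable and an independent residual is enough. The covariance matrix may be
  singular. The condition \<open>q > 1\<close>, that is \<open>m \<ge> 1\<close>, is what lets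
  equality detect correlation with the first variable.\<close>

subsection \<open>The polynomial inequality\<close>

text \<open>The normalized moment \<open>E[U\<^sup>2\<^sup>m Y\<^sup>6] / E[U\<^sup>2\<^sup>m]\<close> for \<open>q = 2m + 1\<close>, where the part of \<open>Y\<close> along \<open>U\<close> has
  variance \<open>a\<^sup>2\<close> and the independent part has variance \<open>s\<close>.\<close>

definition weighted_moment :: "real \<Rightarrow> real \<Rightarrow> real \<Rightarrow> real" where
  "weighted_moment q a s =
     q * (q + 2) * (q + 4) * a ^ 6 + 15 * q * (q + 2) * a ^ 4 * s + 45 * q * a\<^sup>2 * s\<^sup>2 + 15 * s ^ 3"

text \<open>The normalized moment of \<open>X\<^sub>2\<^sup>2 X\<^sub>3\<^sup>2 X\<^sub>4\<^sup>2\<close> under the weight \<open>X\<^sub>1\<^sup>2\<^sup>m\<close>: \<open>a, b, c\<close> are the components along the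
  normalized \<open>X\<^sub>1\<close>; the residual covariance matrix has diagonal \<open>p, r, u\<close> and off-diagonal entries
  \<open>x\<close> (for \<open>X\<^sub>3, X\<^sub>4\<close>), \<open>y\<close> (for \<open>X\<^sub>2, X\<^sub>4\<close>) and \<open>z\<close> (for \<open>X\<^sub>2, X\<^sub>3\<close>).\<close>

definition gpi_poly ::
    "real \<Rightarrow> real \<Rightarrow> real \<Rightarrow> real \<Rightarrow> real \<Rightarrow> real \<Rightarrow> real \<Rightarrow> real \<Rightarrow> real \<Rightarrow> real \<Rightarrow> real" where
  "gpi_poly q a b c p r u x y z =
     q * (q + 2) * (q + 4) * (a * b * c)\<^sup>2
   + q * (q + 2) * (a\<^sup>2 * b\<^sup>2 * u + a\<^sup>2 * c\<^sup>2 * r + b\<^sup>2 * c\<^sup>2 * p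
       + 4 * a * b * c * (a * x + b * y + c * z))
   + q * (a\<^sup>2 * (r * u + 2 * x\<^sup>2) + b\<^sup>2 * (p * u + 2 * y\<^sup>2) + c\<^sup>2 * (p * r + 2 * z\<^sup>2)
       + 4 * (a * b * (z * u + 2 * x * y) + a * c * (y * r + 2 * x * z) + b * c * (x * p + 2 * y * z)))
   + (p * r * u + 2 * (p * x\<^sup>2 + r * y\<^sup>2 + u * z\<^sup>2) + 8 * x * y * z)"

text \<open>With \<open>t\<close> the normalized first variable, the orthogonal polynomials
  \<open>t\<close>, \<open>t^2 - q\<close>, \<open>t^3 - (q + 2) * t\<close> have squared norms
  \<open>q\<close>, \<open>2 * q\<close>, \<open>2 * q * (q + 2)\<close> under the weight.
  Subtracting the values at \<open>q = 1\<close> gives the factors \<open>q - 1\<close>,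
  \<open>2 * (q - 1)\<close> and \<open>2 * (q - 1) * (q + 3)\<close>. What precedes these terms is
  the permanent; what follows is the squared norm of the degree-1 component, along \<open>t\<close>
  (factor \<open>q\<close>) and along the residual variables.\<close>

lemma gpi_poly_eq:
  "gpi_poly q a b c p r u x y z =
     (p + a\<^sup>2) * (r + b\<^sup>2) * (u + c\<^sup>2) + (p + a\<^sup>2) * (x + b * c)\<^sup>2
   + ((r + b\<^sup>2) * (y + a * c)\<^sup>2 + (u + c\<^sup>2) * (z + a * b)\<^sup>2 + 2 * (x + b * c) * (y + a * c) * (z + a * b))
   + (q - 1) * (a\<^sup>2 * (r * u + x\<^sup>2) + b\<^sup>2 * (p * u + y\<^sup>2) + c\<^sup>2 * (p * r + z\<^sup>2)
       + 2 * (a * b * (u * z + x * y) + a * c * (r * y + x * z) + b * c * (p * x + y * z)))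
   + 2 * (q - 1) * (p * (b * c)\<^sup>2 + r * (a * c)\<^sup>2 + u * (a * b)\<^sup>2
       + 2 * (z * (b * c) * (a * c) + y * (b * c) * (a * b) + x * (a * c) * (a * b)))
   + 2 * (q - 1) * (q + 3) * (a * b * c)\<^sup>2
   + q * ((q + 2) * (a * b * c) + a * x + b * y + c * z)\<^sup>2
   + (p * (q * (b * c) + x)\<^sup>2 + r * (q * (a * c) + y)\<^sup>2 + u * (q * (a * b) + z)\<^sup>2
       + 2 * (z * (q * (b * c) + x) * (q * (a * c) + y) + y * (q * (b * c) + x) * (q * (a * b) + z)
            + x * (q * (a * c) + y) * (q * (a * b) + z)))"
  unfolding gpi_poly_def by algebra

section \<open>Polarization of a product of three squares into sixth powers\<close>

text \<open>The weights 1, -2, 1 form a second central difference. It sends a power of the index to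
  2 if the exponent is even and positive, and to 0 otherwise. Among monomials of degree 6 only the
  exponents (2, 2, 2) survive all three differences, with multinomial coefficient 90, and 8 * 90 =
  720.\<close>

lemma polarization6:
  fixes f g h :: real
  shows "720 * (f\<^sup>2 * g\<^sup>2 * h\<^sup>2) =
    (\<Sum>i\<in>{-1,0,1::real}. \<Sum>j\<in>{-1,0,1::real}. \<Sum>k\<in>{-1,0,1::real}.
       (if i = 0 then -2 else 1) * (if j = 0 then -2 else 1) * (if k = 0 then -2 else 1) * (i * f + j * g + k * h) ^ 6)"
  by simp algebra

text \<open>This is the image of the previous identity under the normalized weighted expectation:
  the arguments of \<open>weighted_moment\<close> are the component along the first variable and the
  residual variance of the combination with coefficients \<open>i\<close>, \<open>j\<close>,
  \<open>k\<close>.\<close>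

lemma polarization_weighted_moment:
  "720 * gpi_poly q a b c p r u x y z =
    (\<Sum>i\<in>{-1,0,1::real}. \<Sum>j\<in>{-1,0,1::real}. \<Sum>k\<in>{-1,0,1::real}.
       (if i = 0 then -2 else 1) * (if j = 0 then -2 else 1) * (if k = 0 then -2 else 1) *
       weighted_moment q (i * a + j * b + k * c) (p * i\<^sup>2 + r * j\<^sup>2 + u * k\<^sup>2 + 2 * (z * i * j + y * i * k + x * j * k)))"
  unfolding weighted_moment_def gpi_poly_def
  by simp algebra

section \<open>The lower bound for \<open>gpi_poly\<close> and its equality case\<close>

lemma gpi_poly_bound:
  fixes p :: real
  assumes q: "q > 1"
    and psd: "\<And>f g h. 0 \<le> p * f\<^sup>2 + r * g\<^sup>2 + u * h\<^sup>2 + 2 * (z * f * g + y * f * h + x * g * h)"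
    and N: "0 \<le> a\<^sup>2 * (r * u + x\<^sup>2) + b\<^sup>2 * (p * u + y\<^sup>2) + c\<^sup>2 * (p * r + z\<^sup>2)
       + 2 * (a * b * (u * z + x * y) + a * c * (r * y + x * z) + b * c * (p * x + y * z))"
    and pos: "p + a\<^sup>2 > 0" "r + b\<^sup>2 > 0" "u + c\<^sup>2 > 0"
  shows "(p + a\<^sup>2) * (r + b\<^sup>2) * (u + c\<^sup>2) \<le> gpi_poly q a b c p r u x y z"
    and "gpi_poly q a b c p r u x y z = (p + a\<^sup>2) * (r + b\<^sup>2) * (u + c\<^sup>2) \<Longrightarrow>
      a = 0 \<and> b = 0 \<and> c = 0 \<and> x = 0 \<and> y = 0 \<and> z = 0"
proof -
  define T1 where "T1 = (p + a\<^sup>2) * (x + b * c)\<^sup>2"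
  define T2 where "T2 = (r + b\<^sup>2) * (y + a * c)\<^sup>2 + (u + c\<^sup>2) * (z + a * b)\<^sup>2
     + 2 * (x + b * c) * (y + a * c) * (z + a * b)"
  define T3 where "T3 = a\<^sup>2 * (r * u + x\<^sup>2) + b\<^sup>2 * (p * u + y\<^sup>2) + c\<^sup>2 * (p * r + z\<^sup>2)
       + 2 * (a * b * (u * z + x * y) + a * c * (r * y + x * z) + b * c * (p * x + y * z))"
  define T4 where "T4 = p * (b * c)\<^sup>2 + r * (a * c)\<^sup>2 + u * (a * b)\<^sup>2
       + 2 * (z * (b * c) * (a * c) + y * (b * c) * (a * b) + x * (a * c) * (a * b))"
  define T5 where "T5 = 2 * (q - 1) * (q + 3) * (a * b * c)\<^sup>2"
  define T6 where "T6 = q * ((q + 2) * (a * b * c) + a * x + b * y + c * z)\<^sup>2"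
  define T7 where "T7 = p * (q * (b * c) + x)\<^sup>2 + r * (q * (a * c) + y)\<^sup>2 + u * (q * (a * b) + z)\<^sup>2
       + 2 * (z * (q * (b * c) + x) * (q * (a * c) + y) + y * (q * (b * c) + x) * (q * (a * b) + z)
            + x * (q * (a * c) + y) * (q * (a * b) + z))"
  have eq: "gpi_poly q a b c p r u x y z = (p + a\<^sup>2) * (r + b\<^sup>2) * (u + c\<^sup>2)
      + T1 + T2 + (q - 1) * T3 + 2 * (q - 1) * T4 + T5 + T6 + T7"
    unfolding gpi_poly_eq T1_def T2_def T3_def T4_def T5_def T6_def T7_def by (simp add: add.assoc)
  \<comment> \<open>\<open>T2\<close> is the full covariance form of the third and fourth variables,
    evaluated at their covariances with the second in swapped order. It splits into the residual
    form and a rank-one square.\<close>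
  have "T2 = (r * (y + a * c)\<^sup>2 + u * (z + a * b)\<^sup>2 + 2 * x * (y + a * c) * (z + a * b))
      + (b * (y + a * c) + c * (z + a * b))\<^sup>2"
    unfolding T2_def by algebra
  moreover have "0 \<le> r * (y + a * c)\<^sup>2 + u * (z + a * b)\<^sup>2 + 2 * x * (y + a * c) * (z + a * b)"
    using psd[of 0 "y + a * c" "z + a * b"] by (simp add: mult.assoc)
  ultimately have T2: "T2 \<ge> 0" by simp
  have T1: "T1 \<ge> 0" and T5: "T5 \<ge> 0" and T6: "T6 \<ge> 0" and T3: "T3 \<ge> 0"
    using q pos N by (auto simp: T1_def T5_def T6_def T3_def)
  have T4: "T4 \<ge> 0" and T7: "T7 \<ge> 0"
    using psd[of "b * c" "a * c" "a * b"] psd[of "q * (b * c) + x" "q * (a * c) + y" "q * (a * b) + z"]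
    by (simp_all add: T4_def T7_def)
  have T34: "0 \<le> (q - 1) * T3" "0 \<le> 2 * (q - 1) * T4" using T3 T4 q by auto
  show "(p + a\<^sup>2) * (r + b\<^sup>2) * (u + c\<^sup>2) \<le> gpi_poly q a b c p r u x y z"
    unfolding eq using T1 T2 T34 T5 T6 T7 by linarith
  assume "gpi_poly q a b c p r u x y z = (p + a\<^sup>2) * (r + b\<^sup>2) * (u + c\<^sup>2)"
  then have "T1 = 0" "T2 = 0" "(q - 1) * T3 = 0" "2 * (q - 1) * T4 = 0" "T5 = 0"
    unfolding eq using T1 T2 T34 T5 T6 T7 by linarith+
  then have z: "T1 = 0" "T2 = 0" "T3 = 0" "T4 = 0" "a * b * c = 0"
    using q by (auto simp: T5_def)
  \<comment> \<open>The positive variance in \<open>T1\<close> forces one covariance to vanish. This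
    removes the cross term of \<open>T2\<close>, leaving two squares with positive coefficients, so
    no definiteness of the covariance matrix is required.\<close>
  have x: "x + b * c = 0" using z(1) pos by (simp add: T1_def)
  then have "(r + b\<^sup>2) * (y + a * c)\<^sup>2 + (u + c\<^sup>2) * (z + a * b)\<^sup>2 = 0" using z(2) by (simp add: T2_def)
  then have yz: "y + a * c = 0" "z + a * b = 0"
    using pos by (auto simp: add_nonneg_eq_0_iff)
  have xyz: "x = - b * c" "y = - a * c" "z = - a * b" using x yz by auto
  \<comment> \<open>One of the three components is zero, say \<open>a\<close>. Then
    \<open>p = p + a\<^sup>2\<close> is positive and \<open>T4\<close> reduces to
    \<open>p * (b * c)\<^sup>2\<close>.\<close>
  have "a * b = 0 \<and> a * c = 0 \<and> b * c = 0"
    using z(4,5) pos by (auto simp: T4_def)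
  \<comment> \<open>At most one component is left and \<open>x\<close>, \<open>y\<close>,
    \<open>z\<close> vanish. If it is \<open>a\<close>, then \<open>r\<close> and \<open>u\<close>
    are positive and \<open>T3\<close> is \<open>a\<^sup>2 * r * u\<close>.\<close>
  moreover have "a = 0 \<and> b = 0 \<and> c = 0"
    using calculation z(3) pos unfolding T3_def xyz by auto
  ultimately show "a = 0 \<and> b = 0 \<and> c = 0 \<and> x = 0 \<and> y = 0 \<and> z = 0"
    using xyz by simp
qed

subsection \<open>Uncorrelated Gaussians are independent\<close>

text \<open>Normalized to total mass 1, the weight \<open>h\<close> is a probability density, and
  under it \<open>X\<close> has the characteristic function of \<open>\<mu>\<close>; Levy uniqueness
  identifies the law. A weight of total mass 0 cannot be normalized, but then both sides are
  0.\<close>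

lemma integral_eq_of_char:
  fixes X h :: "'a \<Rightarrow> real"
  assumes M: "prob_space M" and X[measurable]: "X \<in> borel_measurable M"
    and h[measurable]: "h \<in> borel_measurable M" and h0: "\<And>\<omega>. 0 \<le> h \<omega>" and hC: "\<And>\<omega>. h \<omega> \<le> C"
    and \<mu>: "real_distribution \<mu>"
    and ch: "\<And>s. (LINT \<omega>|M. h \<omega> *\<^sub>R iexp (s * X \<omega>)) = (LINT \<omega>|M. h \<omega>) *\<^sub>R char \<mu> s"
    and A: "A \<in> sets borel"
  shows "(LINT \<omega>|M. h \<omega> * indicator A (X \<omega>)) = (LINT \<omega>|M. h \<omega>) * measure \<mu> A"
proof -
  interpret prob_space M by fact
  have ih: "integrable M h"
    by (rule integrable_const_bound[where B = C]) (use h0 hC in auto)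
  show ?thesis
  proof (cases "(LINT \<omega>|M. h \<omega>) = 0")
    case True
    then have "AE \<omega> in M. h \<omega> = 0"
      using ih h0 by (simp add: integral_nonneg_eq_0_iff_AE)
    then have "(LINT \<omega>|M. h \<omega> * indicator A (X \<omega>)) = (LINT \<omega>|M. 0)"
      using A by (intro integral_cong_AE) auto
    with True show ?thesis by simp
  next
    case False
    define c where "c = (LINT \<omega>|M. h \<omega>)"
    have c: "c > 0"
      using False h0 unfolding c_def by (simp add: order_less_le)
    define N where "N = density M (\<lambda>\<omega>. ennreal (h \<omega> / c))"
    have "emeasure N (space N) = (\<integral>\<^sup>+ \<omega>. ennreal (h \<omega> / c) \<partial>M)"
      unfolding N_def by (subst emeasure_density) (auto cong: nn_integral_cong)
    also have "\<dots> = ennreal (LINT \<omega>|M. h \<omega> / c)"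
      using c h0 ih by (intro nn_integral_eq_integral) auto
    also have "(LINT \<omega>|M. h \<omega> / c) = 1"
      using c by (simp add: c_def)
    finally interpret N: prob_space N
      by (intro prob_spaceI) simp
    have XN[measurable]: "X \<in> borel_measurable N" by (simp add: N_def)
    define \<nu> where "\<nu> = distr N borel X"
    have \<nu>: "real_distribution \<nu>"
      unfolding \<nu>_def by (rule N.real_distribution_distr) simp
    have "char \<nu> s = char \<mu> s" for s
    proof -
      have "char \<nu> s = (LINT \<omega>|N. iexp (s * X \<omega>))"
        unfolding char_def \<nu>_def by (subst integral_distr) auto
      also have "\<dots> = (LINT \<omega>|M. (h \<omega> / c) *\<^sub>R iexp (s * X \<omega>))"
        unfolding N_def using h0 c by (subst integral_density) auto
      also have "\<dots> = (LINT \<omega>|M. (1 / c) *\<^sub>R (h \<omega> *\<^sub>R iexp (s * X \<omega>)))"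
        by (intro Bochner_Integration.integral_cong) auto
      also have "\<dots> = (1 / c) *\<^sub>R (LINT \<omega>|M. h \<omega> *\<^sub>R iexp (s * X \<omega>))"
        by (rule integral_scaleR_right)
      also have "\<dots> = char \<mu> s"
        using c by (subst ch) (simp add: c_def)
      finally show ?thesis .
    qed
    then have eq: "\<nu> = \<mu>"
      by (intro Levy_uniqueness \<nu> \<mu>) auto
    have "measure \<nu> A = (LINT y|\<nu>. indicator A y)"
      using A by (simp add: \<nu>_def)
    also have "\<dots> = (LINT \<omega>|N. indicator A (X \<omega>))"
      unfolding \<nu>_def using A by (subst integral_distr) auto
    also have "\<dots> = (LINT \<omega>|M. (h \<omega> / c) *\<^sub>R indicator A (X \<omega>))"
      unfolding N_def using h0 c A by (subst integral_density) auto
    also have "\<dots> = (LINT \<omega>|M. h \<omega> * indicator A (X \<omega>)) / c"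
      by simp
    finally show ?thesis
      using c eq by (simp add: c_def field_simps)
  qed
qed

text \<open>Levy uniqueness is only available on the line. The factorization is obtained one variable at a time:
  applied to the weights \<open>g (1 + cos U)\<close> and \<open>g (1 + sin U)\<close>, with \<open>U\<close> a linear combination of the other variables,
  it shows that the weight \<open>g\<close> may be replaced by \<open>g \<cdot> 1\<^sub>A(X\<^sub>j)\<close>.\<close>

lemma weighted_char_factor_imp_prob_factor:
  fixes X :: "'i \<Rightarrow> 'a \<Rightarrow> real" and g :: "'a \<Rightarrow> real"
  assumes M: "prob_space M" and "finite J"
    and "\<And>j. j \<in> J \<Longrightarrow> X j \<in> borel_measurable M"
    and "\<And>j. j \<in> J \<Longrightarrow> real_distribution (\<mu> j)"
    and "\<And>j. j \<in> J \<Longrightarrow> A j \<in> sets borel"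
    and "g \<in> borel_measurable M" and "\<And>\<omega>. 0 \<le> g \<omega>" and "\<And>\<omega>. g \<omega> \<le> C"
    and "\<And>t. (LINT \<omega>|M. g \<omega> *\<^sub>R iexp (\<Sum>j\<in>J. t j * X j \<omega>))
             = (LINT \<omega>|M. g \<omega>) *\<^sub>R (\<Prod>j\<in>J. char (\<mu> j) (t j))"
  shows "(LINT \<omega>|M. g \<omega> * (\<Prod>j\<in>J. indicator (A j) (X j \<omega>)))
         = (LINT \<omega>|M. g \<omega>) * (\<Prod>j\<in>J. measure (\<mu> j) (A j))"
  using assms(2-)
proof (induction J arbitrary: g C rule: finite_induct)
  case empty
  then show ?case by simp
next
  case (insert j K)
  interpret prob_space M by fact
  note [measurable] = \<open>g \<in> borel_measurable M\<close>
  have Xm[measurable]: "X i \<in> borel_measurable M" if "i \<in> insert j K" for i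
    using insert.prems that by auto
  have Xj[measurable]: "X j \<in> borel_measurable M" by (rule Xm) simp
  have Am[measurable]: "A j \<in> sets borel" using insert.prems by auto
  have C0: "0 \<le> C" using insert.prems(5,6) order_trans by blast
  interpret \<mu>: real_distribution "\<mu> j" using insert.prems by auto
  define g' where "g' \<omega> = g \<omega> * indicator (A j) (X j \<omega>)" for \<omega>
  have gnn: "0 \<le> g \<omega>" "g \<omega> \<le> C" for \<omega> using insert.prems by auto
  have "(LINT \<omega>|M. g' \<omega> *\<^sub>R iexp (\<Sum>k\<in>K. t k * X k \<omega>))
          = (LINT \<omega>|M. g' \<omega>) *\<^sub>R (\<Prod>k\<in>K. char (\<mu> k) (t k))" for t
  proof -
    define U where "U \<omega> = (\<Sum>k\<in>K. t k * X k \<omega>)" for \<omega>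
    have U[measurable]: "U \<in> borel_measurable M"
      unfolding U_def by (intro borel_measurable_sum borel_measurable_times) auto
    define c where "c = (LINT \<omega>|M. g \<omega>)"
    have int: "integrable M (\<lambda>\<omega>. g \<omega> *\<^sub>R iexp (f \<omega>))" if [measurable]: "f \<in> borel_measurable M" for f
      by (rule integrable_const_bound[where B = C]) (use gnn in auto)
    have intr: "integrable M (\<lambda>\<omega>. g \<omega> * f \<omega>)"
      if [measurable]: "f \<in> borel_measurable M" and "\<And>\<omega>. \<bar>f \<omega>\<bar> \<le> 1" for f
      by (rule integrable_const_bound[where B = C])
         (use gnn that in \<open>auto simp: abs_mult intro!: mult_le_one order_trans[OF mult_left_le]\<close>)
    \<comment> \<open>The values 1 and -1 of \<open>\<epsilon>\<close> supply the two exponentials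
      that make up the cosine and sine of \<open>U\<close>; the value 0 gives the marginal of
      \<open>X j\<close>.\<close>
    have joint: "(LINT \<omega>|M. g \<omega> *\<^sub>R iexp (s * X j \<omega> + \<epsilon> * U \<omega>))
        = c *\<^sub>R (char (\<mu> j) s * (\<Prod>k\<in>K. char (\<mu> k) (\<epsilon> * t k)))" for s \<epsilon>
    proof -
      have "(\<Sum>i\<in>insert j K. (if i = j then s else \<epsilon> * t i) * X i \<omega>) = s * X j \<omega> + \<epsilon> * U \<omega>" for \<omega>
      proof -
        have "(\<Sum>i\<in>K. (if i = j then s else \<epsilon> * t i) * X i \<omega>) = (\<Sum>i\<in>K. \<epsilon> * (t i * X i \<omega>))"
          using insert.hyps by (intro sum.cong) auto
        then show ?thesis using insert.hyps by (simp add: U_def sum_distrib_left)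
      qed
      moreover have "(\<Prod>i\<in>insert j K. char (\<mu> i) (if i = j then s else \<epsilon> * t i))
          = char (\<mu> j) s * (\<Prod>k\<in>K. char (\<mu> k) (\<epsilon> * t k))"
      proof -
        have "(\<Prod>i\<in>K. char (\<mu> i) (if i = j then s else \<epsilon> * t i)) = (\<Prod>k\<in>K. char (\<mu> k) (\<epsilon> * t k))"
          using insert.hyps by (intro prod.cong) auto
        then show ?thesis using insert.hyps by simp
      qed
      ultimately show ?thesis
        using insert.prems(7)[of "\<lambda>i. if i = j then s else \<epsilon> * t i"] by (simp add: c_def)
    qed
    have jm: "(LINT \<omega>|M. g \<omega> *\<^sub>R iexp (s * X j \<omega>)) = c *\<^sub>R char (\<mu> j) s" for s
    proof -
      have "char (\<mu> k) 0 = 1" if "k \<in> K" for k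
      proof -
        interpret \<mu>k: real_distribution "\<mu> k" using insert.prems that by auto
        show ?thesis by (rule \<mu>k.char_zero)
      qed
      then show ?thesis using joint[of s 0] by simp
    qed
    \<comment> \<open>The function \<open>g * f\<close> may change sign, so it is no density. Since
      \<open>f\<close> is at least -1, \<open>g * (1 + f)\<close> is nonnegative, bounded by
      \<open>2 * C\<close>, and the contribution of \<open>g\<close> alone can be subtracted
      afterwards.\<close>
    have tilt: "(LINT \<omega>|M. g' \<omega> * f \<omega>) = measure (\<mu> j) (A j) * (LINT \<omega>|M. g \<omega> * f \<omega>)"
      if f[measurable]: "f \<in> borel_measurable M" and f1: "\<And>\<omega>. \<bar>f \<omega>\<bar> \<le> 1"
        and cf: "\<And>s. (LINT \<omega>|M. (g \<omega> * f \<omega>) *\<^sub>R iexp (s * X j \<omega>)) = (LINT \<omega>|M. g \<omega> * f \<omega>) *\<^sub>R char (\<mu> j) s"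
      for f
    proof -
      have i1: "integrable M (\<lambda>\<omega>. g \<omega> * f \<omega>)" by (rule intr[OF f f1])
      have i0: "integrable M g" using intr[of "\<lambda>_. 1"] by simp
      have f1': "-1 \<le> f \<omega>" "f \<omega> \<le> 1" for \<omega> using f1[of \<omega>] by auto
      have a: "(LINT \<omega>|M. (g \<omega> * (1 + f \<omega>)) * indicator (A j) (X j \<omega>))
          = (LINT \<omega>|M. g \<omega> * (1 + f \<omega>)) * measure (\<mu> j) (A j)"
      proof (rule integral_eq_of_char[where C = "2 * C", OF M])
        show "0 \<le> g \<omega> * (1 + f \<omega>)" for \<omega> using gnn f1'[of \<omega>] by simp
        show "g \<omega> * (1 + f \<omega>) \<le> 2 * C" for \<omega>
          using mult_mono[of "g \<omega>" C "1 + f \<omega>" 2] gnn f1'[of \<omega>] C0 by simp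
        show "(LINT \<omega>|M. (g \<omega> * (1 + f \<omega>)) *\<^sub>R iexp (s * X j \<omega>))
            = (LINT \<omega>|M. g \<omega> * (1 + f \<omega>)) *\<^sub>R char (\<mu> j) s" for s
        proof -
          have "integrable M (\<lambda>\<omega>. (g \<omega> * f \<omega>) *\<^sub>R iexp (s * X j \<omega>))"
            by (rule Bochner_Integration.integrable_bound[OF i1]) auto
          note If = this
          have Ig: "integrable M (\<lambda>\<omega>. g \<omega> *\<^sub>R iexp (s * X j \<omega>))" by (rule int) simp
          have "(LINT \<omega>|M. (g \<omega> * (1 + f \<omega>)) *\<^sub>R iexp (s * X j \<omega>))
             = (LINT \<omega>|M. g \<omega> *\<^sub>R iexp (s * X j \<omega>) + (g \<omega> * f \<omega>) *\<^sub>R iexp (s * X j \<omega>))"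
            by (intro Bochner_Integration.integral_cong) (auto simp: scaleR_conv_of_real algebra_simps)
          also have "\<dots> = (LINT \<omega>|M. g \<omega> *\<^sub>R iexp (s * X j \<omega>)) + (LINT \<omega>|M. (g \<omega> * f \<omega>) *\<^sub>R iexp (s * X j \<omega>))"
            by (rule Bochner_Integration.integral_add[OF Ig If])
          also have "\<dots> = (LINT \<omega>|M. g \<omega> * (1 + f \<omega>)) *\<^sub>R char (\<mu> j) s"
            unfolding jm cf using i0 i1 by (simp add: c_def algebra_simps)
          finally show ?thesis .
        qed
      qed (use \<mu>.real_distribution_axioms in auto)
      have b: "(LINT \<omega>|M. g \<omega> * indicator (A j) (X j \<omega>)) = (LINT \<omega>|M. g \<omega>) * measure (\<mu> j) (A j)"
        by (rule integral_eq_of_char[where C = C, OF M])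
           (use \<mu>.real_distribution_axioms gnn jm in \<open>auto simp: c_def\<close>)
      have i2: "integrable M g'"
        unfolding g'_def by (rule intr) (auto simp: indicator_def)
      have i3: "integrable M (\<lambda>\<omega>. g' \<omega> * f \<omega>)"
        unfolding g'_def mult.assoc by (rule intr) (use f1 in \<open>auto simp: indicator_def\<close>)
      have "(LINT \<omega>|M. g' \<omega>) + (LINT \<omega>|M. g' \<omega> * f \<omega>) = (LINT \<omega>|M. (g \<omega> * (1 + f \<omega>)) * indicator (A j) (X j \<omega>))"
        unfolding Bochner_Integration.integral_add[OF i2 i3, symmetric] by (simp add: g'_def algebra_simps)
      moreover have "(LINT \<omega>|M. g \<omega> * (1 + f \<omega>)) = (LINT \<omega>|M. g \<omega>) + (LINT \<omega>|M. g \<omega> * f \<omega>)"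
        using i0 i1 by (simp add: distrib_left)
      ultimately have "(LINT \<omega>|M. g' \<omega>) + (LINT \<omega>|M. g' \<omega> * f \<omega>)
          = ((LINT \<omega>|M. g \<omega>) + (LINT \<omega>|M. g \<omega> * f \<omega>)) * measure (\<mu> j) (A j)"
        using a by simp
      then show ?thesis using b by (simp add: g'_def algebra_simps)
    qed
    define P where "P \<epsilon> = (\<Prod>k\<in>K. char (\<mu> k) (\<epsilon> * t k))" for \<epsilon>
    have cosU: "(LINT \<omega>|M. (g \<omega> * cos (U \<omega>)) *\<^sub>R iexp (s * X j \<omega>)) = (c / 2) *\<^sub>R (char (\<mu> j) s * (P 1 + P (-1)))"
      and sinU: "(LINT \<omega>|M. (g \<omega> * sin (U \<omega>)) *\<^sub>R iexp (s * X j \<omega>)) = (c / 2) *\<^sub>R (char (\<mu> j) s * (- \<i> * (P 1 - P (-1))))"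
      for s
    proof -
      have e: "iexp (s * X j \<omega> + 1 * U \<omega>) = iexp (s * X j \<omega>) * (cos (U \<omega>) + \<i> * sin (U \<omega>))"
        "iexp (s * X j \<omega> + - 1 * U \<omega>) = iexp (s * X j \<omega>) * (cos (U \<omega>) - \<i> * sin (U \<omega>))" for \<omega>
        unfolding cis_conv_exp[symmetric]
        by (simp_all add: complex_eq_iff cos_add sin_add cos_diff sin_diff algebra_simps)
      have I: "integrable M (\<lambda>\<omega>. g \<omega> *\<^sub>R iexp (s * X j \<omega> + \<epsilon> * U \<omega>))" for \<epsilon> by (rule int) simp
      have "(LINT \<omega>|M. (g \<omega> * cos (U \<omega>)) *\<^sub>R iexp (s * X j \<omega>))
          = (LINT \<omega>|M. (1/2) *\<^sub>R (g \<omega> *\<^sub>R iexp (s * X j \<omega> + 1 * U \<omega>) + g \<omega> *\<^sub>R iexp (s * X j \<omega> + - 1 * U \<omega>)))"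
        unfolding e by (intro Bochner_Integration.integral_cong) (auto simp: scaleR_conv_of_real algebra_simps)
      also have "\<dots> = (1/2) *\<^sub>R (c *\<^sub>R (char (\<mu> j) s * P 1) + c *\<^sub>R (char (\<mu> j) s * P (-1)))"
        unfolding integral_scaleR_right Bochner_Integration.integral_add[OF I I] joint P_def ..
      finally show "(LINT \<omega>|M. (g \<omega> * cos (U \<omega>)) *\<^sub>R iexp (s * X j \<omega>)) = (c / 2) *\<^sub>R (char (\<mu> j) s * (P 1 + P (-1)))"
        by (simp add: scaleR_conv_of_real algebra_simps)
      have "(LINT \<omega>|M. (g \<omega> * sin (U \<omega>)) *\<^sub>R iexp (s * X j \<omega>))
          = (LINT \<omega>|M. (- \<i> / 2) * (g \<omega> *\<^sub>R iexp (s * X j \<omega> + 1 * U \<omega>) - g \<omega> *\<^sub>R iexp (s * X j \<omega> + - 1 * U \<omega>)))"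
        unfolding e by (intro Bochner_Integration.integral_cong) (auto simp: scaleR_conv_of_real algebra_simps)
      also have "\<dots> = (- \<i> / 2) * (c *\<^sub>R (char (\<mu> j) s * P 1) - c *\<^sub>R (char (\<mu> j) s * P (-1)))"
        unfolding integral_mult_right_zero Bochner_Integration.integral_diff[OF I I] joint P_def ..
      finally show "(LINT \<omega>|M. (g \<omega> * sin (U \<omega>)) *\<^sub>R iexp (s * X j \<omega>)) = (c / 2) *\<^sub>R (char (\<mu> j) s * (- \<i> * (P 1 - P (-1))))"
        by (simp add: scaleR_conv_of_real algebra_simps)
    qed
    \<comment> \<open>Setting \<open>s = 0\<close> identifies the constant in \<open>cosU\<close> as
      the integral of \<open>g * cos U\<close>, which is the form that \<open>tilt\<close> asks for;
      likewise for the sine.\<close>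
    have cos0: "of_real (LINT \<omega>|M. g \<omega> * cos (U \<omega>)) = (c / 2) *\<^sub>R (P 1 + P (-1))"
      using cosU[of 0] by (simp add: \<mu>.char_zero flip: integral_complex_of_real) (simp add: scaleR_conv_of_real)
    have sin0: "of_real (LINT \<omega>|M. g \<omega> * sin (U \<omega>)) = (c / 2) *\<^sub>R (- \<i> * (P 1 - P (-1)))"
      using sinU[of 0] by (simp add: \<mu>.char_zero flip: integral_complex_of_real) (simp add: scaleR_conv_of_real)
    have Tc: "(LINT \<omega>|M. g' \<omega> * cos (U \<omega>)) = measure (\<mu> j) (A j) * (LINT \<omega>|M. g \<omega> * cos (U \<omega>))"
    proof (rule tilt)
      show "(LINT \<omega>|M. (g \<omega> * cos (U \<omega>)) *\<^sub>R iexp (s * X j \<omega>)) = (LINT \<omega>|M. g \<omega> * cos (U \<omega>)) *\<^sub>R char (\<mu> j) s" for s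
        unfolding cosU by (simp only: scaleR_conv_of_real cos0 mult_ac)
    qed auto
    have Ts: "(LINT \<omega>|M. g' \<omega> * sin (U \<omega>)) = measure (\<mu> j) (A j) * (LINT \<omega>|M. g \<omega> * sin (U \<omega>))"
    proof (rule tilt)
      show "(LINT \<omega>|M. (g \<omega> * sin (U \<omega>)) *\<^sub>R iexp (s * X j \<omega>)) = (LINT \<omega>|M. g \<omega> * sin (U \<omega>)) *\<^sub>R char (\<mu> j) s" for s
        unfolding sinU by (simp only: scaleR_conv_of_real sin0 mult_ac)
    qed auto
    have T1: "(LINT \<omega>|M. g' \<omega>) = measure (\<mu> j) (A j) * c"
      using tilt[of "\<lambda>_. 1"] jm by (simp add: c_def)
    have ic: "integrable M (\<lambda>\<omega>. complex_of_real (g' \<omega> * cos (U \<omega>)))"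
      "integrable M (\<lambda>\<omega>. complex_of_real (g' \<omega> * sin (U \<omega>)))"
      unfolding g'_def mult.assoc
      by (intro integrable_of_real intr; auto simp: indicator_def)+
    have "(LINT \<omega>|M. g' \<omega> *\<^sub>R iexp (U \<omega>))
        = (LINT \<omega>|M. complex_of_real (g' \<omega> * cos (U \<omega>)) + \<i> * complex_of_real (g' \<omega> * sin (U \<omega>)))"
      by (intro Bochner_Integration.integral_cong)
         (auto simp: exp_Euler cos_of_real sin_of_real scaleR_conv_of_real algebra_simps)
    also have "\<dots> = of_real (LINT \<omega>|M. g' \<omega> * cos (U \<omega>)) + \<i> * of_real (LINT \<omega>|M. g' \<omega> * sin (U \<omega>))"
      using ic by (subst Bochner_Integration.integral_add) (auto simp del: of_real_mult)
    also have "\<dots> = measure (\<mu> j) (A j) * (of_real (LINT \<omega>|M. g \<omega> * cos (U \<omega>)) + \<i> * of_real (LINT \<omega>|M. g \<omega> * sin (U \<omega>)))"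
      unfolding Tc Ts by (simp add: algebra_simps)
    \<comment> \<open>In cosine plus \<open>\<i>\<close> times sine the contributions of
      \<open>P (-1)\<close> cancel.\<close>
    also have "\<dots> = measure (\<mu> j) (A j) * (c * P 1)"
      unfolding cos0 sin0 by (simp add: scaleR_conv_of_real algebra_simps) (simp add: field_simps)
    finally show ?thesis
      unfolding T1 by (simp add: U_def P_def scaleR_conv_of_real)
  qed
  then have "(LINT \<omega>|M. g' \<omega> * (\<Prod>k\<in>K. indicator (A k) (X k \<omega>)))
         = (LINT \<omega>|M. g' \<omega>) * (\<Prod>k\<in>K. measure (\<mu> k) (A k))"
    using insert.prems gnn C0
    by (intro insert.IH[where C = C]) (auto simp: g'_def indicator_def intro: order_trans)
  moreover have "(LINT \<omega>|M. g' \<omega>) = (LINT \<omega>|M. g \<omega>) * measure (\<mu> j) (A j)"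
  proof -
    have "char (\<mu> k) 0 = 1" if "k \<in> K" for k
    proof -
      interpret \<mu>k: real_distribution "\<mu> k" using insert.prems that by auto
      show ?thesis by (rule \<mu>k.char_zero)
    qed
    moreover have "(\<Sum>i\<in>K. (if i = j then s else 0) * X i \<omega>) = 0" for s \<omega>
      using insert.hyps by (intro sum.neutral) auto
    moreover have "(\<Prod>i\<in>K. char (\<mu> i) (if i = j then s else 0)) = (\<Prod>i\<in>K. char (\<mu> i) 0)" for s
      using insert.hyps by (intro prod.cong) auto
    ultimately have "(LINT \<omega>|M. g \<omega> *\<^sub>R iexp (s * X j \<omega>)) = (LINT \<omega>|M. g \<omega>) *\<^sub>R char (\<mu> j) s" for s
      using insert.prems(7)[of "\<lambda>i. if i = j then s else 0"] insert.hyps by simp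
    then show ?thesis
      unfolding g'_def
      by (intro integral_eq_of_char[where C = C, OF M])
         (use \<mu>.real_distribution_axioms gnn in auto)
  qed
  ultimately show ?case
    using insert.hyps by (simp add: g'_def mult.assoc)
qed

text \<open>Independence means the product formula on every finite subfamily. Coefficients extended
  by 0 outside the subfamily restrict the factorization to it, and the constant weight 1 in the
  preceding lemma turns it into the product formula.\<close>

lemma (in prob_space) indep_vars_of_char_factor:
  fixes X :: "'i \<Rightarrow> 'a \<Rightarrow> real"
  assumes "finite I" and X: "\<And>i. i \<in> I \<Longrightarrow> X i \<in> borel_measurable M"
    and ch: "\<And>t. (LINT \<omega>|M. iexp (\<Sum>i\<in>I. t i * X i \<omega>)) = (\<Prod>i\<in>I. LINT \<omega>|M. iexp (t i * X i \<omega>))"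
  shows "indep_vars (\<lambda>_. borel) X I"
  unfolding indep_vars_def2
proof (intro conjI ballI X indep_setsI)
  fix i assume "i \<in> I"
  then show "{X i -` A \<inter> space M |A. A \<in> sets borel} \<subseteq> events"
    using X by (auto intro: measurable_sets)
next
  fix B J assume J: "J \<noteq> {}" "J \<subseteq> I" "finite J"
    and "\<forall>j\<in>J. B j \<in> {X j -` A \<inter> space M |A. A \<in> sets borel}"
  then have "\<forall>j\<in>J. \<exists>A. A \<in> sets borel \<and> B j = X j -` A \<inter> space M" by blast
  then obtain A where A: "\<And>j. j \<in> J \<Longrightarrow> A j \<in> sets borel \<and> B j = X j -` A j \<inter> space M"
    by metis
  have X': "X j \<in> borel_measurable M" if "j \<in> J" for j using that J X by auto
  have fac: "(LINT \<omega>|M. 1 * (\<Prod>j\<in>J. indicator (A j) (X j \<omega>)))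
         = (LINT \<omega>|M. 1) * (\<Prod>j\<in>J. measure (distr M borel (X j)) (A j))"
  proof (rule weighted_char_factor_imp_prob_factor[where C = 1])
    show "prob_space M" by unfold_locales
    show "real_distribution (distr M borel (X j))" if "j \<in> J" for j
      using X'[OF that] by (rule real_distribution_distr)
    fix t :: "'i \<Rightarrow> real"
    let ?t = "\<lambda>i. if i \<in> J then t i else 0"
    have "(\<Sum>i\<in>I. ?t i * X i \<omega>) = (\<Sum>j\<in>J. t j * X j \<omega>)" for \<omega>
      using J \<open>finite I\<close> by (intro sum.mono_neutral_cong_right) auto
    moreover have "(\<Prod>i\<in>I. LINT \<omega>|M. iexp (?t i * X i \<omega>)) = (\<Prod>j\<in>J. LINT \<omega>|M. iexp (t j * X j \<omega>))"
      using J \<open>finite I\<close> by (intro prod.mono_neutral_cong_right) (auto simp: prob_space)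
    moreover have "char (distr M borel (X j)) (t j) = (LINT \<omega>|M. iexp (t j * X j \<omega>))" if "j \<in> J" for j
      unfolding char_def using X'[OF that] by (subst integral_distr) auto
    ultimately show "(LINT \<omega>|M. 1 *\<^sub>R iexp (\<Sum>j\<in>J. t j * X j \<omega>))
        = (LINT \<omega>|M. 1) *\<^sub>R (\<Prod>j\<in>J. char (distr M borel (X j)) (t j))"
      using ch[of ?t] by (simp add: prob_space)
  qed (use J X' A in auto)
  have ind: "(\<Prod>j\<in>J. indicator (A j) (X j \<omega>)) = (indicator (\<Inter>j\<in>J. B j) \<omega> :: real)"
    if "\<omega> \<in> space M" for \<omega>
    using A that J by (auto simp: indicator_def prod_eq_1_iff)
  have "(\<Inter>j\<in>J. B j) \<in> events"
    using J A measurable_sets[OF X'] by (intro sets.finite_INT) auto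
  then have "prob (\<Inter>j\<in>J. B j) = (LINT \<omega>|M. indicator (\<Inter>j\<in>J. B j) \<omega> :: real)"
    by simp
  also have "\<dots> = (LINT \<omega>|M. 1 * (\<Prod>j\<in>J. indicator (A j) (X j \<omega>)))"
    by (intro Bochner_Integration.integral_cong refl) (simp only: ind mult_1_left)
  also have "\<dots> = (\<Prod>j\<in>J. measure (distr M borel (X j)) (A j))"
    unfolding fac by (simp add: prob_space)
  also have "\<dots> = (\<Prod>j\<in>J. prob (B j))"
    using A X' by (intro prod.cong refl) (simp add: measure_distr)
  finally show "prob (\<Inter>j\<in>J. B j) = (\<Prod>j\<in>J. prob (B j))" .
qed

section \<open>The algebra of functions with all moments\<close>

text \<open>Integrability of a function and of its square would not pass to products; demanding it
  for all powers makes the class an algebra, so every polynomial in Gaussians is integrable by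
  closure rules alone.\<close>

definition all_moments :: "'a measure \<Rightarrow> ('a \<Rightarrow> real) \<Rightarrow> bool" where
  "all_moments M f \<longleftrightarrow> f \<in> borel_measurable M \<and> (\<forall>n. integrable M (\<lambda>x. f x ^ n))"

lemma all_moments_integrable: "all_moments M f \<Longrightarrow> integrable M f"
  by (auto simp: all_moments_def dest: spec[of _ 1])

lemma all_moments_mult:
  assumes "all_moments M f" "all_moments M g"
  shows "all_moments M (\<lambda>x. f x * g x)"
proof -
  have [measurable]: "f \<in> borel_measurable M" "g \<in> borel_measurable M"
    using assms by (auto simp: all_moments_def)
  have "integrable M (\<lambda>x. (f x * g x) ^ n)" for n
  proof (rule Bochner_Integration.integrable_bound)
    show "integrable M (\<lambda>x. f x ^ (2 * n) + g x ^ (2 * n))"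
      using assms by (intro Bochner_Integration.integrable_add) (auto simp: all_moments_def)
    have "\<bar>u * v\<bar> \<le> u\<^sup>2 + v\<^sup>2" for u v :: real
    proof -
      have "2 * \<bar>u * v\<bar> \<le> u\<^sup>2 + v\<^sup>2"
        using sum_squares_bound[of "\<bar>u\<bar>" "\<bar>v\<bar>"] by (simp add: abs_mult)
      then show ?thesis using abs_ge_zero[of "u * v"] by linarith
    qed
    from this[of "f x ^ n" "g x ^ n" for x]
    show "AE x in M. norm ((f x * g x) ^ n) \<le> norm (f x ^ (2 * n) + g x ^ (2 * n))"
      by (intro AE_I2) (simp add: power_mult_distrib mult.commute[of 2] power_mult)
  qed auto
  then show ?thesis by (simp add: all_moments_def)
qed

lemma all_moments_add:
  assumes "all_moments M f" "all_moments M g"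
  shows "all_moments M (\<lambda>x. f x + g x)"
proof -
  have [measurable]: "f \<in> borel_measurable M" "g \<in> borel_measurable M"
    using assms by (auto simp: all_moments_def)
  have "integrable M (\<lambda>x. (f x + g x) ^ n)" for n
  proof (rule Bochner_Integration.integrable_bound)
    have "integrable M (\<lambda>x. \<bar>f x ^ n\<bar>)" "integrable M (\<lambda>x. \<bar>g x ^ n\<bar>)"
      using assms by (auto simp: all_moments_def)
    then show "integrable M (\<lambda>x. 2 ^ n * (\<bar>f x\<bar> ^ n + \<bar>g x\<bar> ^ n))"
      by (intro integrable_mult_right Bochner_Integration.integrable_add) (simp_all add: power_abs)
    have "\<bar>(u + v) ^ n\<bar> \<le> 2 ^ n * (\<bar>u\<bar> ^ n + \<bar>v\<bar> ^ n)" for u v :: real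
    proof -
      have "\<bar>u + v\<bar> ^ n \<le> (2 * max \<bar>u\<bar> \<bar>v\<bar>) ^ n"
        by (intro power_mono) auto
      also have "\<dots> = 2 ^ n * max \<bar>u\<bar> \<bar>v\<bar> ^ n" by (simp add: power_mult_distrib)
      also have "\<dots> \<le> 2 ^ n * (\<bar>u\<bar> ^ n + \<bar>v\<bar> ^ n)"
        by (intro mult_left_mono) (auto simp: max_def)
      finally show ?thesis by (simp add: power_abs)
    qed
    then show "AE x in M. norm ((f x + g x) ^ n) \<le> norm (2 ^ n * (\<bar>f x\<bar> ^ n + \<bar>g x\<bar> ^ n))"
      by (intro AE_I2) simp
  qed auto
  then show ?thesis by (simp add: all_moments_def)
qed

lemma (in finite_measure) all_moments_const: "all_moments M (\<lambda>_. c)"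
  by (simp add: all_moments_def)

lemma (in finite_measure) all_moments_power: "all_moments M f \<Longrightarrow> all_moments M (\<lambda>x. f x ^ n)"
  by (induction n) (auto intro: all_moments_mult all_moments_const)

lemma (in finite_measure) all_moments_diff:
  "all_moments M f \<Longrightarrow> all_moments M g \<Longrightarrow> all_moments M (\<lambda>x. f x - g x)"
  using all_moments_add[of M f "\<lambda>x. (-1) * g x"] all_moments_mult[OF all_moments_const, of g "-1"] by simp

lemmas (in finite_measure) all_moments_intros =
  all_moments_const all_moments_add all_moments_diff all_moments_mult all_moments_power

section \<open>Moments and characteristic functions of one Gaussian\<close>

text \<open>The almost surely vanishing case is included because linear combinations and regression
  residuals of jointly Gaussian variables can degenerate.\<close>

definition centered_gaussian :: "'a measure \<Rightarrow> ('a \<Rightarrow> real) \<Rightarrow> bool" where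
  "centered_gaussian M Y \<longleftrightarrow> Y \<in> borel_measurable M \<and>
     ((AE x in M. Y x = 0) \<or> (\<exists>\<sigma>>0. distributed M lborel Y (normal_density 0 \<sigma>)))"

text \<open>All formulas are expressed through the second moment rather than a standard deviation,
  so they also cover the degenerate case; there the even moment of order 0 relies on
  \<open>0 ^ 0 = 1\<close>.\<close>

lemma (in prob_space)
  assumes Y: "centered_gaussian M Y"
  shows centered_gaussian_all_moments: "all_moments M Y"
    and centered_gaussian_even_moment:
      "expectation (\<lambda>x. Y x ^ (2 * k)) = expectation (\<lambda>x. (Y x)\<^sup>2) ^ k * (fact (2 * k) / (2 ^ k * fact k))"
    and centered_gaussian_odd_moment: "expectation (\<lambda>x. Y x ^ (2 * k + 1)) = 0"
    and centered_gaussian_char: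
      "(LINT x|M. iexp (t * Y x)) = exp (- (t\<^sup>2 * expectation (\<lambda>x. (Y x)\<^sup>2)) / 2)"
proof -
  have [measurable]: "Y \<in> borel_measurable M" using Y by (simp add: centered_gaussian_def)
  have "all_moments M Y \<and>
     expectation (\<lambda>x. Y x ^ (2 * k)) = expectation (\<lambda>x. (Y x)\<^sup>2) ^ k * (fact (2 * k) / (2 ^ k * fact k)) \<and>
     expectation (\<lambda>x. Y x ^ (2 * k + 1)) = 0 \<and>
     (LINT x|M. iexp (t * Y x)) = exp (- (t\<^sup>2 * expectation (\<lambda>x. (Y x)\<^sup>2)) / 2)"
  proof (cases "AE x in M. Y x = 0")
    case True
    \<comment> \<open>The codomain is kept general so that the same fact serves real powers and the
      complex exponential.\<close>
    have eq: "expectation (\<lambda>x. f (Y x)) = f 0" and int: "integrable M (\<lambda>x. f (Y x))"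
      if [measurable]: "f \<in> borel_measurable borel" for f :: "real \<Rightarrow> 'b::{banach,second_countable_topology}"
    proof -
      have ae: "AE x in M. f (Y x) = f 0" using True by auto
      show "expectation (\<lambda>x. f (Y x)) = f 0"
        using integral_cong_AE[OF _ _ ae] by (simp add: prob_space)
      show "integrable M (\<lambda>x. f (Y x))"
        using integrable_cong_AE[OF _ _ ae] by simp
    qed
    have "expectation (\<lambda>x. Y x ^ (2 * k + 1)) = 0"
      using eq[of "\<lambda>y. y ^ (2 * k + 1)"] by simp
    then show ?thesis
      using int[of "\<lambda>y. y ^ n" for n] eq[of "\<lambda>y. y ^ n" for n] int[of "\<lambda>y. y"] eq[of "\<lambda>y. y"] eq[of "\<lambda>y. iexp (t * y)"]
      by (auto simp: all_moments_def power_0_left)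
  next
    case False
    then obtain \<sigma> where \<sigma>: "\<sigma> > 0" and D: "distributed M lborel Y (normal_density 0 \<sigma>)"
      using Y by (auto simp: centered_gaussian_def)
    have m: "expectation (\<lambda>x. Y x ^ n) = (LINT y|lborel. normal_density 0 \<sigma> y * y ^ n)" for n
      by (subst distributed_integral[OF D, symmetric]) auto
    have i: "integrable M (\<lambda>x. Y x ^ n)" for n
      using integrable_normal_moment[OF \<sigma>, of 0 n]
      by (subst distributed_integrable[OF D, symmetric]) auto
    have ev: "expectation (\<lambda>x. Y x ^ (2 * k)) = \<sigma>\<^sup>2 ^ k * (fact (2 * k) / (2 ^ k * fact k))" for k
      unfolding m using integral_normal_moment_even[OF \<sigma>, of 0 k] \<sigma>
      by (simp add: power_divide field_simps)
    have sq: "expectation (\<lambda>x. (Y x)\<^sup>2) = \<sigma>\<^sup>2"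
      using ev[of 1] by (simp add: numeral_eq_Suc)
    have odd: "expectation (\<lambda>x. Y x ^ (2 * k + 1)) = 0"
      unfolding m using integral_normal_moment_odd[OF \<sigma>, of 0 k] by simp
    have D': "distributed M lborel (\<lambda>x. Y x / \<sigma>) std_normal_density"
      using D normal_standard_normal_convert[OF \<sigma>, of Y 0] by simp
    have "(LINT x|M. iexp (t * Y x)) = (LINT x|M. iexp ((t * \<sigma>) * (Y x / \<sigma>)))"
      using \<sigma> by simp
    also have "\<dots> = char (distr M lborel (\<lambda>x. Y x / \<sigma>)) (t * \<sigma>)"
      unfolding char_def by (subst integral_distr) auto
    also have "distr M lborel (\<lambda>x. Y x / \<sigma>) = std_normal_distribution"
      using D' by (rule distributed_distr_eq_density)
    also have "char std_normal_distribution (t * \<sigma>) = exp (- (t\<^sup>2 * \<sigma>\<^sup>2) / 2)"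
      by (simp add: char_std_normal_distribution power_mult_distrib exp_of_real)
    finally show ?thesis
      using i ev[of k] odd sq by (simp add: all_moments_def)
  qed
  then show "all_moments M Y"
    "expectation (\<lambda>x. Y x ^ (2 * k)) = expectation (\<lambda>x. (Y x)\<^sup>2) ^ k * (fact (2 * k) / (2 ^ k * fact k))"
    "expectation (\<lambda>x. Y x ^ (2 * k + 1)) = 0"
    "(LINT x|M. iexp (t * Y x)) = exp (- (t\<^sup>2 * expectation (\<lambda>x. (Y x)\<^sup>2)) / 2)"
    by blast+
qed

text \<open>The characteristic function of a centered Gaussian depends only on its variance. Without
  correlations the variance of a linear combination is the sum of the variances of its terms, and
  the exponential turns this sum into a product.\<close>

lemma (in prob_space) uncorrelated_gaussian_imp_indep_vars:
  fixes Y :: "'i \<Rightarrow> 'a \<Rightarrow> real"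
  assumes J: "finite J" and G: "\<And>t. centered_gaussian M (\<lambda>x. \<Sum>j\<in>J. t j * Y j x)"
    and unc: "\<And>i j. i \<in> J \<Longrightarrow> j \<in> J \<Longrightarrow> i \<noteq> j \<Longrightarrow> expectation (\<lambda>x. Y i x * Y j x) = 0"
  shows "indep_vars (\<lambda>_. borel) Y J"
proof (rule indep_vars_of_char_factor[OF J])
  have Y: "centered_gaussian M (Y j)" if "j \<in> J" for j
  proof -
    have "(\<Sum>i\<in>J. (if i = j then 1 else 0) * Y i x) = Y j x" for x
      using that J by (simp add: if_distrib[where f = "\<lambda>c. c * _"] cong: if_cong)
    then show ?thesis using G[of "\<lambda>i. if i = j then 1 else 0"] by simp
  qed
  then show "Y j \<in> borel_measurable M" if "j \<in> J" for j
    using that by (simp add: centered_gaussian_def)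
  fix t
  have i: "integrable M (\<lambda>x. Y i x * Y j x)" if "i \<in> J" "j \<in> J" for i j
    using that by (intro all_moments_integrable all_moments_mult centered_gaussian_all_moments Y)
  have "expectation (\<lambda>x. (\<Sum>j\<in>J. t j * Y j x)\<^sup>2) = expectation (\<lambda>x. \<Sum>i\<in>J. \<Sum>j\<in>J. (t i * t j) * (Y i x * Y j x))"
    unfolding power2_eq_square sum_product by (simp add: mult_ac)
  also have "\<dots> = (\<Sum>i\<in>J. \<Sum>j\<in>J. (t i * t j) * expectation (\<lambda>x. Y i x * Y j x))"
    using i by (simp add: Bochner_Integration.integral_sum Bochner_Integration.integrable_sum cong: sum.cong)
  also have "\<dots> = (\<Sum>i\<in>J. (t i)\<^sup>2 * expectation (\<lambda>x. (Y i x)\<^sup>2))"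
  proof (rule sum.cong)
    fix i assume i: "i \<in> J"
    have "(\<Sum>j\<in>J. (t i * t j) * expectation (\<lambda>x. Y i x * Y j x)) = (\<Sum>j\<in>J. if j = i then (t i)\<^sup>2 * expectation (\<lambda>x. (Y i x)\<^sup>2) else 0)"
      using unc[OF i] by (intro sum.cong) (auto simp: power2_eq_square)
    then show "(\<Sum>j\<in>J. (t i * t j) * expectation (\<lambda>x. Y i x * Y j x)) = (t i)\<^sup>2 * expectation (\<lambda>x. (Y i x)\<^sup>2)"
      using i J by simp
  qed simp
  finally have var: "expectation (\<lambda>x. (\<Sum>j\<in>J. t j * Y j x)\<^sup>2) = (\<Sum>i\<in>J. (t i)\<^sup>2 * expectation (\<lambda>x. (Y i x)\<^sup>2))" .
  have "(LINT x|M. iexp (\<Sum>j\<in>J. t j * Y j x)) = exp (- (\<Sum>i\<in>J. (t i)\<^sup>2 * expectation (\<lambda>x. (Y i x)\<^sup>2)) / 2)"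
    using centered_gaussian_char[OF G[of t], of 1] by (simp add: var)
  also have "\<dots> = (\<Prod>i\<in>J. complex_of_real (exp (- ((t i)\<^sup>2 * expectation (\<lambda>x. (Y i x)\<^sup>2)) / 2)))"
    using J by (simp add: sum_divide_distrib exp_sum flip: sum_negf of_real_prod)
  also have "\<dots> = (\<Prod>i\<in>J. LINT x|M. iexp (t i * Y i x))"
    by (intro prod.cong refl) (simp only: centered_gaussian_char[OF Y])
  finally show "(LINT x|M. iexp (\<Sum>j\<in>J. t j * Y j x)) = (\<Prod>i\<in>J. LINT x|M. iexp (t i * Y i x))" .
qed

section \<open>A sixth power against an even power of another Gaussian\<close>

lemma (in prob_space) uncorrelated_gaussian_mixed_moment:
  fixes U Z :: "'a \<Rightarrow> real"
  assumes G: "\<And>\<alpha> \<beta>. centered_gaussian M (\<lambda>x. \<alpha> * U x + \<beta> * Z x)"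
    and unc: "expectation (\<lambda>x. U x * Z x) = 0"
  shows "expectation (\<lambda>x. U x ^ k * Z x ^ l) = expectation (\<lambda>x. U x ^ k) * expectation (\<lambda>x. Z x ^ l)"
proof -
  have U: "all_moments M U" and Z: "all_moments M Z"
    using centered_gaussian_all_moments[OF G[of 1 0]] centered_gaussian_all_moments[OF G[of 0 1]] by simp_all
  have "indep_vars (\<lambda>_. borel) (case_bool U Z) UNIV"
  proof (rule uncorrelated_gaussian_imp_indep_vars)
    show "centered_gaussian M (\<lambda>x. \<Sum>j\<in>UNIV. t j * (case j of True \<Rightarrow> U | False \<Rightarrow> Z) x)" for t
      using G[of "t True" "t False"] by (simp add: UNIV_bool add.commute)
    show "expectation (\<lambda>x. (case i of True \<Rightarrow> U | False \<Rightarrow> Z) x * (case j of True \<Rightarrow> U | False \<Rightarrow> Z) x) = 0"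
      if "i \<noteq> j" for i j
      using that unc by (cases i; cases j) (auto simp: mult.commute)
  qed simp
  moreover have "(\<lambda>_::bool. borel :: real measure) = case_bool borel borel"
    by (auto split: bool.split)
  ultimately have "indep_var borel U borel Z"
    by (simp only: indep_var_def)
  then have "indep_var borel ((\<lambda>u. u ^ k) \<circ> U) borel ((\<lambda>u. u ^ l) \<circ> Z)"
    by (rule indep_var_compose) auto
  then show ?thesis
    using U Z by (subst indep_var_lebesgue_integral[symmetric]) (auto simp: comp_def all_moments_def)
qed

text \<open>In this recursive form the order \<open>2 * m\<close> moment factors out of the three
  higher ones, leaving exactly the factors \<open>q\<close>, \<open>q + 2\<close>,
  \<open>q + 4\<close>.\<close>

lemma (in prob_space) centered_gaussian_even_moment_Suc:
  assumes "centered_gaussian M Y"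
  shows "expectation (\<lambda>x. Y x ^ (2 * k + 2)) = (2 * real k + 1) * expectation (\<lambda>x. (Y x)\<^sup>2) * expectation (\<lambda>x. Y x ^ (2 * k))"
proof -
  have "fact (2 * Suc k) / (2 ^ Suc k * fact (Suc k)) = (2 * k + 1) * (fact (2 * k) / (2 ^ k * fact k) :: real)"
    by (simp add: divide_simps)
  then show ?thesis
    using centered_gaussian_even_moment[OF assms, of "Suc k"] centered_gaussian_even_moment[OF assms, of k]
    by simp
qed

text \<open>Subtracting the regression of \<open>Y\<close> on \<open>U\<close> leaves
  \<open>Z\<close>, uncorrelated with \<open>U\<close> and hence independent of it. In the binomial
  expansion the odd powers of \<open>Z\<close> have mean 0, and four terms remain.\<close>

lemma (in prob_space) weighted_sixth_moment:
  fixes U Y :: "'a \<Rightarrow> real"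
  assumes G: "\<And>\<alpha> \<beta>. centered_gaussian M (\<lambda>x. \<alpha> * U x + \<beta> * Y x)"
    and v: "v = expectation (\<lambda>x. (U x)\<^sup>2)" "v > 0"
    and a: "a = expectation (\<lambda>x. U x * Y x) / sqrt v"
  shows "expectation (\<lambda>x. U x ^ (2 * m) * Y x ^ 6)
    = expectation (\<lambda>x. U x ^ (2 * m)) * weighted_moment (2 * m + 1) a (expectation (\<lambda>x. (Y x)\<^sup>2) - a\<^sup>2)"
proof -
  define \<beta> where "\<beta> = a / sqrt v"
  define Z where "Z x = Y x - \<beta> * U x" for x
  have \<beta>v: "\<beta>\<^sup>2 * v = a\<^sup>2" and \<beta>c: "\<beta> * v = expectation (\<lambda>x. U x * Y x)"
    using v(2) by (simp_all add: \<beta>_def a power_divide power2_eq_square)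
  have GU: "centered_gaussian M U" and GY: "centered_gaussian M Y" using G[of 1 0] G[of 0 1] by simp_all
  have GZ: "centered_gaussian M (\<lambda>x. \<alpha> * U x + \<gamma> * Z x)" for \<alpha> \<gamma>
    using G[of "\<alpha> - \<gamma> * \<beta>" \<gamma>] by (simp add: Z_def algebra_simps)
  have GZ1: "centered_gaussian M Z" using GZ[of 0 1] by simp
  note am = GU[THEN centered_gaussian_all_moments] GY[THEN centered_gaussian_all_moments]
    GZ1[THEN centered_gaussian_all_moments]
  have UZ: "expectation (\<lambda>x. U x * Z x) = 0"
  proof -
    have "expectation (\<lambda>x. U x * Z x) = expectation (\<lambda>x. U x * Y x - \<beta> * (U x)\<^sup>2)"
      by (simp add: Z_def algebra_simps power2_eq_square)
    also have "\<dots> = expectation (\<lambda>x. U x * Y x) - \<beta> * v"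
      unfolding v(1) by (subst Bochner_Integration.integral_diff)
        (auto intro!: all_moments_integrable all_moments_intros am)
    finally show ?thesis using \<beta>c by simp
  qed
  define s where "s = expectation (\<lambda>x. (Z x)\<^sup>2)"
  have s: "s = expectation (\<lambda>x. (Y x)\<^sup>2) - a\<^sup>2"
  proof -
    have "expectation (\<lambda>x. (Y x)\<^sup>2) = expectation (\<lambda>x. (Z x)\<^sup>2 + 2 * \<beta> * (U x * Z x) + \<beta>\<^sup>2 * (U x)\<^sup>2)"
      by (intro Bochner_Integration.integral_cong) (auto simp: Z_def power2_eq_square algebra_simps)
    also have "\<dots> = s + 2 * \<beta> * expectation (\<lambda>x. U x * Z x) + \<beta>\<^sup>2 * v"
      unfolding v(1) s_def
      by (simp add: all_moments_integrable all_moments_intros am)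
    finally show ?thesis using UZ \<beta>v by simp
  qed
  define E where "E n = expectation (\<lambda>x. U x ^ n)" for n
  have E: "E (2 * k + 2) = (2 * real k + 1) * v * E (2 * k)" for k
    unfolding E_def v(1) by (rule centered_gaussian_even_moment_Suc[OF GU])
  define F where "F n = expectation (\<lambda>x. Z x ^ n)" for n
  have F: "F 0 = 1" "F 1 = 0" "F 2 = s" "F 3 = 0" "F 4 = 3 * s\<^sup>2" "F 5 = 0" "F 6 = 15 * s ^ 3"
  proof -
    show "F 0 = 1" by (simp add: F_def prob_space)
    show "F 1 = 0" "F 3 = 0" "F 5 = 0"
      using centered_gaussian_odd_moment[OF GZ1, of 0] centered_gaussian_odd_moment[OF GZ1, of 1]
        centered_gaussian_odd_moment[OF GZ1, of 2] by (simp_all add: F_def)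
    show F2: "F 2 = s" by (simp add: F_def s_def)
    show F4: "F 4 = 3 * s\<^sup>2"
      using centered_gaussian_even_moment_Suc[OF GZ1, of 1] F2 by (simp add: F_def power2_eq_square)
    show "F 6 = 15 * s ^ 3"
      using centered_gaussian_even_moment_Suc[OF GZ1, of 2] F2 F4
      by (simp add: F_def power2_eq_square power3_eq_cube)
  qed
  have mm: "expectation (\<lambda>x. c * (U x ^ k * Z x ^ l)) = c * (E k * F l)" for c k l
    using uncorrelated_gaussian_mixed_moment[OF GZ UZ] by (simp add: E_def F_def)
  have int: "integrable M (\<lambda>x. c * (U x ^ k * Z x ^ l))" for c k l
    by (intro all_moments_integrable all_moments_intros am)
  have "expectation (\<lambda>x. U x ^ (2 * m) * Y x ^ 6) =
      expectation (\<lambda>x. \<beta> ^ 6 * (U x ^ (2 * m + 6) * Z x ^ 0) + (6 * \<beta> ^ 5) * (U x ^ (2 * m + 5) * Z x ^ 1)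
        + (15 * \<beta> ^ 4) * (U x ^ (2 * m + 4) * Z x ^ 2) + (20 * \<beta> ^ 3) * (U x ^ (2 * m + 3) * Z x ^ 3)
        + (15 * \<beta> ^ 2) * (U x ^ (2 * m + 2) * Z x ^ 4) + (6 * \<beta>) * (U x ^ (2 * m + 1) * Z x ^ 5)
        + 1 * (U x ^ (2 * m) * Z x ^ 6))"
  proof (intro Bochner_Integration.integral_cong refl)
    have "w * (\<beta> * u + z) ^ 6 = \<beta> ^ 6 * (w * u ^ 6 * z ^ 0) + (6 * \<beta> ^ 5) * (w * u ^ 5 * z ^ 1)
        + (15 * \<beta> ^ 4) * (w * u ^ 4 * z ^ 2) + (20 * \<beta> ^ 3) * (w * u ^ 3 * z ^ 3)
        + (15 * \<beta> ^ 2) * (w * u ^ 2 * z ^ 4) + (6 * \<beta>) * (w * u ^ 1 * z ^ 5) + 1 * (w * z ^ 6)" for w u z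
      by algebra
    moreover have "Y x = \<beta> * U x + Z x" for x by (simp add: Z_def)
    ultimately show "U x ^ (2 * m) * Y x ^ 6 = \<beta> ^ 6 * (U x ^ (2 * m + 6) * Z x ^ 0) + (6 * \<beta> ^ 5) * (U x ^ (2 * m + 5) * Z x ^ 1)
        + (15 * \<beta> ^ 4) * (U x ^ (2 * m + 4) * Z x ^ 2) + (20 * \<beta> ^ 3) * (U x ^ (2 * m + 3) * Z x ^ 3)
        + (15 * \<beta> ^ 2) * (U x ^ (2 * m + 2) * Z x ^ 4) + (6 * \<beta>) * (U x ^ (2 * m + 1) * Z x ^ 5)
        + 1 * (U x ^ (2 * m) * Z x ^ 6)" for x
      by (simp only: power_add)
  qed
  also have "\<dots> = \<beta> ^ 6 * (E (2 * m + 6) * F 0) + (6 * \<beta> ^ 5) * (E (2 * m + 5) * F 1)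
      + (15 * \<beta> ^ 4) * (E (2 * m + 4) * F 2) + (20 * \<beta> ^ 3) * (E (2 * m + 3) * F 3)
      + (15 * \<beta> ^ 2) * (E (2 * m + 2) * F 4) + (6 * \<beta>) * (E (2 * m + 1) * F 5)
      + 1 * (E (2 * m) * F 6)"
    by (simp only: Bochner_Integration.integral_add Bochner_Integration.integrable_add int mm)
  also have "\<dots> = \<beta> ^ 6 * E (2 * m + 6) + 15 * \<beta> ^ 4 * (E (2 * m + 4) * s)
      + 15 * \<beta>\<^sup>2 * (E (2 * m + 2) * (3 * s\<^sup>2)) + E (2 * m) * (15 * s ^ 3)"
    unfolding F by simp
  also have "\<dots> = E (2 * m) * weighted_moment (2 * m + 1) a s"
  proof -
    define q where "q = real (2 * m + 1)"
    have k: "2 * (m + 1) = 2 * m + 2" "2 * m + 2 + 2 = 2 * m + 4"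
      "2 * (m + 2) = 2 * m + 4" "2 * m + 4 + 2 = 2 * m + 6" by simp_all
    have q: "2 * real m + 1 = q" "2 * real (m + 1) + 1 = q + 2" "2 * real (m + 2) + 1 = q + 4"
      by (simp_all add: q_def)
    note e = E[of m, unfolded q] E[of "m + 1", unfolded k q] E[of "m + 2", unfolded k q]
    \<comment> \<open>Writing the powers of \<open>a\<close> through
      \<open>\<beta>\<^sup>2 * v\<close> removes the square root, so that the claim becomes a
      polynomial identity.\<close>
    have "a ^ 6 = (a\<^sup>2) ^ 3" "a ^ 4 = (a\<^sup>2)\<^sup>2" by (simp_all flip: power_mult)
    then have a46: "a ^ 6 = (\<beta>\<^sup>2 * v) ^ 3" "a ^ 4 = (\<beta>\<^sup>2 * v)\<^sup>2"
      by (simp_all only: \<beta>v)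
    show ?thesis
      unfolding e weighted_moment_def a46 \<beta>v[symmetric] q_def[symmetric] by algebra
  qed
  finally show ?thesis unfolding s E_def .
qed

subsection \<open>Four jointly Gaussian variables\<close>

lemma (in prob_space) expectation_square_linear3:
  assumes "all_moments M X" "all_moments M Y" "all_moments M W"
  shows "expectation (\<lambda>\<omega>. (f * X \<omega> + g * Y \<omega> + h * W \<omega>)\<^sup>2)
    = f\<^sup>2 * expectation (\<lambda>\<omega>. (X \<omega>)\<^sup>2) + g\<^sup>2 * expectation (\<lambda>\<omega>. (Y \<omega>)\<^sup>2) + h\<^sup>2 * expectation (\<lambda>\<omega>. (W \<omega>)\<^sup>2)
      + 2 * f * g * expectation (\<lambda>\<omega>. X \<omega> * Y \<omega>) + 2 * f * h * expectation (\<lambda>\<omega>. X \<omega> * W \<omega>)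
      + 2 * g * h * expectation (\<lambda>\<omega>. Y \<omega> * W \<omega>)"
proof -
  have "(f * X \<omega> + g * Y \<omega> + h * W \<omega>)\<^sup>2 = f\<^sup>2 * (X \<omega>)\<^sup>2 + g\<^sup>2 * (Y \<omega>)\<^sup>2 + h\<^sup>2 * (W \<omega>)\<^sup>2
      + 2 * f * g * (X \<omega> * Y \<omega>) + 2 * f * h * (X \<omega> * W \<omega>) + 2 * g * h * (Y \<omega> * W \<omega>)" for \<omega>
    by algebra
  then show ?thesis
    by (simp add: all_moments_integrable all_moments_intros assms)
qed

text \<open>The locale fixes the parameters of \<open>gpi_poly\<close>. The combination of
  \<open>X\<close>, \<open>Y\<close>, \<open>W\<close> is bracketed apart from \<open>U\<close> to
  match the two-variable lemma above, and \<open>U_pos\<close> permits normalizing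
  \<open>U\<close>.\<close>

locale gaussian_quadruple = prob_space M for M :: "'a measure" +
  fixes U X Y W :: "'a \<Rightarrow> real"
  assumes gaussian: "\<And>e f g h. centered_gaussian M (\<lambda>\<omega>. e * U \<omega> + (f * X \<omega> + g * Y \<omega> + h * W \<omega>))"
    and U_pos: "expectation (\<lambda>\<omega>. (U \<omega>)\<^sup>2) > 0"
begin

definition v where "v = expectation (\<lambda>\<omega>. (U \<omega>)\<^sup>2)"
definition a where "a = expectation (\<lambda>\<omega>. U \<omega> * X \<omega>) / sqrt v"
definition b where "b = expectation (\<lambda>\<omega>. U \<omega> * Y \<omega>) / sqrt v"
definition c where "c = expectation (\<lambda>\<omega>. U \<omega> * W \<omega>) / sqrt v"
definition p where "p = expectation (\<lambda>\<omega>. (X \<omega>)\<^sup>2) - a\<^sup>2"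
definition r where "r = expectation (\<lambda>\<omega>. (Y \<omega>)\<^sup>2) - b\<^sup>2"
definition u where "u = expectation (\<lambda>\<omega>. (W \<omega>)\<^sup>2) - c\<^sup>2"
definition x where "x = expectation (\<lambda>\<omega>. Y \<omega> * W \<omega>) - b * c"
definition y where "y = expectation (\<lambda>\<omega>. X \<omega> * W \<omega>) - a * c"
definition z where "z = expectation (\<lambda>\<omega>. X \<omega> * Y \<omega>) - a * b"

lemma all_moments_UXYW:
  "all_moments M U" "all_moments M X" "all_moments M Y" "all_moments M W"
  using gaussian[of 1 0 0 0] gaussian[of 0 1 0 0] gaussian[of 0 0 1 0] gaussian[of 0 0 0 1]
  by (auto intro: centered_gaussian_all_moments)

lemmas moment_intros = all_moments_integrable all_moments_intros all_moments_UXYW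

lemma v_pos: "v > 0" using U_pos by (simp add: v_def)

lemma cross_moment:
  "expectation (\<lambda>\<omega>. U \<omega> * (f * X \<omega> + g * Y \<omega> + h * W \<omega>)) / sqrt v = f * a + g * b + h * c"
proof -
  have "U \<omega> * (f * X \<omega> + g * Y \<omega> + h * W \<omega>) = f * (U \<omega> * X \<omega>) + g * (U \<omega> * Y \<omega>) + h * (U \<omega> * W \<omega>)" for \<omega>
    by algebra
  then show ?thesis
    by (simp add: moment_intros a_def b_def c_def add_divide_distrib)
qed

lemma residual_second_moment:
  "expectation (\<lambda>\<omega>. (f * X \<omega> + g * Y \<omega> + h * W \<omega>)\<^sup>2) - (f * a + g * b + h * c)\<^sup>2
    = p * f\<^sup>2 + r * g\<^sup>2 + u * h\<^sup>2 + 2 * (z * f * g + y * f * h + x * g * h)"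
  unfolding expectation_square_linear3[OF all_moments_UXYW(2-4)] p_def r_def u_def x_def y_def z_def
  by algebra

text \<open>The form is the second moment of what remains of the linear combination after its
  regression on \<open>U\<close> is subtracted.\<close>

lemma residual_nonneg: "0 \<le> p * f\<^sup>2 + r * g\<^sup>2 + u * h\<^sup>2 + 2 * (z * f * g + y * f * h + x * g * h)"
proof -
  let ?Y = "\<lambda>\<omega>. f * X \<omega> + g * Y \<omega> + h * W \<omega>"
  let ?l = "f * a + g * b + h * c"
  have l: "expectation (\<lambda>\<omega>. U \<omega> * ?Y \<omega>) = ?l * sqrt v"
    using cross_moment[of f g h] v_pos by (simp add: field_simps)
  have "0 \<le> expectation (\<lambda>\<omega>. (?Y \<omega> - ?l / sqrt v * U \<omega>)\<^sup>2)"
    by (rule Bochner_Integration.integral_nonneg) simp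
  also have "\<dots> = expectation (\<lambda>\<omega>. (?Y \<omega>)\<^sup>2 - 2 * (?l / sqrt v) * (U \<omega> * ?Y \<omega>) + (?l / sqrt v)\<^sup>2 * (U \<omega>)\<^sup>2)"
    by (intro Bochner_Integration.integral_cong refl) algebra
  also have "\<dots> = expectation (\<lambda>\<omega>. (?Y \<omega>)\<^sup>2) - 2 * (?l / sqrt v) * expectation (\<lambda>\<omega>. U \<omega> * ?Y \<omega>) + (?l / sqrt v)\<^sup>2 * v"
    by (simp only: Bochner_Integration.integral_add Bochner_Integration.integral_diff integral_mult_right_zero
         Bochner_Integration.integrable_diff moment_intros v_def)
  also have "\<dots> = expectation (\<lambda>\<omega>. (?Y \<omega>)\<^sup>2) - ?l\<^sup>2"
    unfolding l using v_pos by (simp add: power_divide power2_eq_square)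
  finally show ?thesis unfolding residual_second_moment .
qed

text \<open>With \<open>Q\<close> the symmetric matrix of the quadratic form \<open>a Y W + b X W + c X Y\<close> and \<open>S\<close> the
  residual covariance matrix, the claim is \<open>tr (Q S Q S) \<ge> 0\<close>; it is the expectation of \<open>(Q Z)\<^sup>T S (Q Z)\<close>
  for the residual vector \<open>Z\<close>, which is nonnegative pointwise.\<close>
lemma trace_nonneg:
  "0 \<le> a\<^sup>2 * (r * u + x\<^sup>2) + b\<^sup>2 * (p * u + y\<^sup>2) + c\<^sup>2 * (p * r + z\<^sup>2)
       + 2 * (a * b * (u * z + x * y) + a * c * (r * y + x * z) + b * c * (p * x + y * z))"
proof -
  define ZX where "ZX \<omega> = X \<omega> - a / sqrt v * U \<omega>" for \<omega>
  define ZY where "ZY \<omega> = Y \<omega> - b / sqrt v * U \<omega>" for \<omega>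
  define ZW where "ZW \<omega> = W \<omega> - c / sqrt v * U \<omega>" for \<omega>
  have Z: "all_moments M ZX" "all_moments M ZY" "all_moments M ZW"
    unfolding ZX_def ZY_def ZW_def by (intro moment_intros)+
  have cov: "expectation (\<lambda>\<omega>. (A \<omega> - k / sqrt v * U \<omega>) * (B \<omega> - l / sqrt v * U \<omega>))
      = expectation (\<lambda>\<omega>. A \<omega> * B \<omega>) - k * l"
    if A: "all_moments M A" and B: "all_moments M B" and k: "k = expectation (\<lambda>\<omega>. U \<omega> * A \<omega>) / sqrt v"
      and l: "l = expectation (\<lambda>\<omega>. U \<omega> * B \<omega>) / sqrt v" for A B k l
  proof -
    have "expectation (\<lambda>\<omega>. (A \<omega> - k / sqrt v * U \<omega>) * (B \<omega> - l / sqrt v * U \<omega>))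
      = expectation (\<lambda>\<omega>. A \<omega> * B \<omega> - l / sqrt v * (U \<omega> * A \<omega>) - k / sqrt v * (U \<omega> * B \<omega>)
          + (k / sqrt v * (l / sqrt v)) * (U \<omega>)\<^sup>2)"
      by (intro Bochner_Integration.integral_cong refl) algebra
    also have "\<dots> = expectation (\<lambda>\<omega>. A \<omega> * B \<omega>) - l / sqrt v * expectation (\<lambda>\<omega>. U \<omega> * A \<omega>)
        - k / sqrt v * expectation (\<lambda>\<omega>. U \<omega> * B \<omega>) + (k / sqrt v * (l / sqrt v)) * v"
      by (simp only: Bochner_Integration.integral_add Bochner_Integration.integral_diff integral_mult_right_zero
           Bochner_Integration.integrable_diff moment_intros A B v_def)
    also have "\<dots> = expectation (\<lambda>\<omega>. A \<omega> * B \<omega>) - k * l"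
    proof -
      have "expectation (\<lambda>\<omega>. U \<omega> * A \<omega>) = k * sqrt v" "expectation (\<lambda>\<omega>. U \<omega> * B \<omega>) = l * sqrt v"
        using k l v_pos by simp_all
      then show ?thesis using v_pos by simp
    qed
    finally show ?thesis .
  qed
  have m: "expectation (\<lambda>\<omega>. (ZX \<omega>)\<^sup>2) = p" "expectation (\<lambda>\<omega>. (ZY \<omega>)\<^sup>2) = r" "expectation (\<lambda>\<omega>. (ZW \<omega>)\<^sup>2) = u"
    "expectation (\<lambda>\<omega>. ZX \<omega> * ZY \<omega>) = z" "expectation (\<lambda>\<omega>. ZX \<omega> * ZW \<omega>) = y" "expectation (\<lambda>\<omega>. ZY \<omega> * ZW \<omega>) = x"
    unfolding ZX_def ZY_def ZW_def power2_eq_square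
    by (simp_all only: cov[OF _ _ a_def a_def] cov[OF _ _ b_def b_def] cov[OF _ _ c_def c_def] cov[OF _ _ a_def b_def]
         cov[OF _ _ a_def c_def] cov[OF _ _ b_def c_def] all_moments_UXYW p_def r_def u_def x_def y_def z_def power2_eq_square)
  \<comment> \<open>These are the entries of the gradient of the quadratic form at the residual
    vector: off-diagonal coefficients \<open>a\<close>, \<open>b\<close>, \<open>c\<close>, zero
    diagonal. With this scaling the expectation is twice the claimed expression.\<close>
  let ?f = "\<lambda>\<omega>. c * ZY \<omega> + b * ZW \<omega>" and ?g = "\<lambda>\<omega>. c * ZX \<omega> + a * ZW \<omega>" and ?h = "\<lambda>\<omega>. b * ZX \<omega> + a * ZY \<omega>"
  have "0 \<le> expectation (\<lambda>\<omega>. p * (?f \<omega>)\<^sup>2 + r * (?g \<omega>)\<^sup>2 + u * (?h \<omega>)\<^sup>2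
      + 2 * (z * ?f \<omega> * ?g \<omega> + y * ?f \<omega> * ?h \<omega> + x * ?g \<omega> * ?h \<omega>))"
    by (rule Bochner_Integration.integral_nonneg) (rule residual_nonneg)
  also have "\<dots> = expectation (\<lambda>\<omega>. (r * c\<^sup>2 + u * b\<^sup>2 + 2 * x * b * c) * (ZX \<omega>)\<^sup>2
      + (p * c\<^sup>2 + u * a\<^sup>2 + 2 * y * a * c) * (ZY \<omega>)\<^sup>2 + (p * b\<^sup>2 + r * a\<^sup>2 + 2 * z * a * b) * (ZW \<omega>)\<^sup>2
      + (2 * u * a * b + 2 * z * c\<^sup>2 + 2 * y * b * c + 2 * x * a * c) * (ZX \<omega> * ZY \<omega>)
      + (2 * r * a * c + 2 * z * b * c + 2 * y * b\<^sup>2 + 2 * x * a * b) * (ZX \<omega> * ZW \<omega>)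
      + (2 * p * b * c + 2 * z * a * c + 2 * y * a * b + 2 * x * a\<^sup>2) * (ZY \<omega> * ZW \<omega>))"
    by (intro Bochner_Integration.integral_cong refl) algebra
  also have "\<dots> = (r * c\<^sup>2 + u * b\<^sup>2 + 2 * x * b * c) * p
      + (p * c\<^sup>2 + u * a\<^sup>2 + 2 * y * a * c) * r + (p * b\<^sup>2 + r * a\<^sup>2 + 2 * z * a * b) * u
      + (2 * u * a * b + 2 * z * c\<^sup>2 + 2 * y * b * c + 2 * x * a * c) * z
      + (2 * r * a * c + 2 * z * b * c + 2 * y * b\<^sup>2 + 2 * x * a * b) * y
      + (2 * p * b * c + 2 * z * a * c + 2 * y * a * b + 2 * x * a\<^sup>2) * x"
    by (simp only: Bochner_Integration.integral_add integral_mult_right_zero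
         Bochner_Integration.integrable_add integrable_mult_right moment_intros Z m)
  also have "\<dots> = 2 * (a\<^sup>2 * (r * u + x\<^sup>2) + b\<^sup>2 * (p * u + y\<^sup>2) + c\<^sup>2 * (p * r + z\<^sup>2)
       + 2 * (a * b * (u * z + x * y) + a * c * (r * y + x * z) + b * c * (p * x + y * z)))"
    by algebra
  finally show ?thesis by simp
qed

text \<open>Polarization is applied under the expectation, the sixth moment is evaluated for each
  linear combination, and the polynomial polarization identity collects the result; the factor 720
  cancels.\<close>

lemma product_moment:
  "expectation (\<lambda>\<omega>. U \<omega> ^ (2 * m) * (X \<omega>)\<^sup>2 * (Y \<omega>)\<^sup>2 * (W \<omega>)\<^sup>2)
    = expectation (\<lambda>\<omega>. U \<omega> ^ (2 * m)) * gpi_poly (2 * m + 1) a b c p r u x y z"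
proof -
  define d :: "real \<Rightarrow> real" where "d i = (if i = 0 then -2 else 1)" for i
  let ?S = "{-1, 0, 1 :: real}"
  let ?L = "\<lambda>i j k \<omega>. i * X \<omega> + j * Y \<omega> + k * W \<omega>"
  have wm: "expectation (\<lambda>\<omega>. U \<omega> ^ (2 * m) * ?L i j k \<omega> ^ 6) = expectation (\<lambda>\<omega>. U \<omega> ^ (2 * m)) *
      weighted_moment (2 * m + 1) (i * a + j * b + k * c)
        (p * i\<^sup>2 + r * j\<^sup>2 + u * k\<^sup>2 + 2 * (z * i * j + y * i * k + x * j * k))" for i j k
  proof -
    have "centered_gaussian M (\<lambda>\<omega>. \<alpha> * U \<omega> + \<beta> * ?L i j k \<omega>)" for \<alpha> \<beta>
      using gaussian[of \<alpha> "\<beta> * i" "\<beta> * j" "\<beta> * k"] by (simp add: algebra_simps)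
    from weighted_sixth_moment[OF this v_def v_pos cross_moment[symmetric]]
    show ?thesis unfolding residual_second_moment .
  qed
  have int: "integrable M (\<lambda>\<omega>. d i * d j * d k * (U \<omega> ^ (2 * m) * ?L i j k \<omega> ^ 6))" for i j k
    by (intro moment_intros)
  have "720 * expectation (\<lambda>\<omega>. U \<omega> ^ (2 * m) * (X \<omega>)\<^sup>2 * (Y \<omega>)\<^sup>2 * (W \<omega>)\<^sup>2)
      = expectation (\<lambda>\<omega>. U \<omega> ^ (2 * m) * (720 * ((X \<omega>)\<^sup>2 * (Y \<omega>)\<^sup>2 * (W \<omega>)\<^sup>2)))"
    by (simp add: mult_ac flip: integral_mult_right_zero)
  also have "\<dots> = expectation (\<lambda>\<omega>. \<Sum>i\<in>?S. \<Sum>j\<in>?S. \<Sum>k\<in>?S. d i * d j * d k * (U \<omega> ^ (2 * m) * ?L i j k \<omega> ^ 6))"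
    unfolding polarization6 d_def[symmetric] sum_distrib_left
    by (intro Bochner_Integration.integral_cong sum.cong refl) (simp only: mult_ac)
  also have "\<dots> = (\<Sum>i\<in>?S. \<Sum>j\<in>?S. \<Sum>k\<in>?S. d i * d j * d k * expectation (\<lambda>\<omega>. U \<omega> ^ (2 * m) * ?L i j k \<omega> ^ 6))"
    by (simp only: Bochner_Integration.integral_sum Bochner_Integration.integrable_sum int integral_mult_right_zero)
  also have "\<dots> = expectation (\<lambda>\<omega>. U \<omega> ^ (2 * m)) * (720 * gpi_poly (2 * m + 1) a b c p r u x y z)"
    unfolding wm polarization_weighted_moment d_def[symmetric] sum_distrib_left
    by (intro sum.cong refl) (simp only: mult_ac)
  finally show ?thesis by simp
qed

lemma even_moment_pos: "expectation (\<lambda>\<omega>. U \<omega> ^ (2 * m)) > 0"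
proof -
  have "centered_gaussian M U" using gaussian[of 1 0 0 0] by simp
  from centered_gaussian_even_moment[OF this, of m] U_pos show ?thesis by simp
qed

lemma gaussian_product_inequality:
  assumes m: "m \<ge> 1"
    and pos: "expectation (\<lambda>\<omega>. (X \<omega>)\<^sup>2) > 0" "expectation (\<lambda>\<omega>. (Y \<omega>)\<^sup>2) > 0" "expectation (\<lambda>\<omega>. (W \<omega>)\<^sup>2) > 0"
  defines "R \<equiv> expectation (\<lambda>\<omega>. U \<omega> ^ (2 * m)) * expectation (\<lambda>\<omega>. (X \<omega>)\<^sup>2) * expectation (\<lambda>\<omega>. (Y \<omega>)\<^sup>2)
      * expectation (\<lambda>\<omega>. (W \<omega>)\<^sup>2)"
  shows "R \<le> expectation (\<lambda>\<omega>. U \<omega> ^ (2 * m) * (X \<omega>)\<^sup>2 * (Y \<omega>)\<^sup>2 * (W \<omega>)\<^sup>2)"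
    and "expectation (\<lambda>\<omega>. U \<omega> ^ (2 * m) * (X \<omega>)\<^sup>2 * (Y \<omega>)\<^sup>2 * (W \<omega>)\<^sup>2) = R \<Longrightarrow>
      expectation (\<lambda>\<omega>. U \<omega> * X \<omega>) = 0 \<and> expectation (\<lambda>\<omega>. U \<omega> * Y \<omega>) = 0 \<and> expectation (\<lambda>\<omega>. U \<omega> * W \<omega>) = 0 \<and>
      expectation (\<lambda>\<omega>. X \<omega> * Y \<omega>) = 0 \<and> expectation (\<lambda>\<omega>. X \<omega> * W \<omega>) = 0 \<and> expectation (\<lambda>\<omega>. Y \<omega> * W \<omega>) = 0"
proof -
  have q: "1 < real (2 * m + 1)" using m by simp
  have s: "p + a\<^sup>2 = expectation (\<lambda>\<omega>. (X \<omega>)\<^sup>2)" "r + b\<^sup>2 = expectation (\<lambda>\<omega>. (Y \<omega>)\<^sup>2)"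
    "u + c\<^sup>2 = expectation (\<lambda>\<omega>. (W \<omega>)\<^sup>2)"
    by (simp_all add: p_def r_def u_def)
  have R: "R = expectation (\<lambda>\<omega>. U \<omega> ^ (2 * m)) * ((p + a\<^sup>2) * (r + b\<^sup>2) * (u + c\<^sup>2))"
    by (simp add: R_def s)
  note bound = gpi_poly_bound[OF q residual_nonneg trace_nonneg, unfolded s, OF pos, folded s]
  show "R \<le> expectation (\<lambda>\<omega>. U \<omega> ^ (2 * m) * (X \<omega>)\<^sup>2 * (Y \<omega>)\<^sup>2 * (W \<omega>)\<^sup>2)"
    unfolding product_moment R using bound(1) even_moment_pos[of m] by (intro mult_left_mono) auto
  assume "expectation (\<lambda>\<omega>. U \<omega> ^ (2 * m) * (X \<omega>)\<^sup>2 * (Y \<omega>)\<^sup>2 * (W \<omega>)\<^sup>2) = R"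
  then have "a = 0 \<and> b = 0 \<and> c = 0 \<and> x = 0 \<and> y = 0 \<and> z = 0"
    unfolding product_moment R using even_moment_pos[of m] by (intro bound(2)) simp
  then show "expectation (\<lambda>\<omega>. U \<omega> * X \<omega>) = 0 \<and> expectation (\<lambda>\<omega>. U \<omega> * Y \<omega>) = 0 \<and> expectation (\<lambda>\<omega>. U \<omega> * W \<omega>) = 0 \<and>
      expectation (\<lambda>\<omega>. X \<omega> * Y \<omega>) = 0 \<and> expectation (\<lambda>\<omega>. X \<omega> * W \<omega>) = 0 \<and> expectation (\<lambda>\<omega>. Y \<omega> * W \<omega>) = 0"
    using v_pos by (simp add: a_def b_def c_def x_def y_def z_def)
qed

end

theorem theorem4p2:
  fixes M :: "'a measure" and X :: "nat \<Rightarrow> 'a \<Rightarrow> real" and m :: nat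
  assumes "m \<ge> 1"
    and "prob_space M"
    and "centered_gaussian_vector M {1..4} X"
    and "\<forall>i\<in>{1..4}. prob_space.variance M (X i) > 0"
  shows "prob_space.expectation M (\<lambda>x. X 1 x ^ (2*m) * X 2 x ^ 2 * X 3 x ^ 2 * X 4 x ^ 2)
           \<ge> prob_space.expectation M (\<lambda>x. X 1 x ^ (2*m)) * prob_space.expectation M (\<lambda>x. X 2 x ^ 2)
             * prob_space.expectation M (\<lambda>x. X 3 x ^ 2) * prob_space.expectation M (\<lambda>x. X 4 x ^ 2)
       \<and> (prob_space.expectation M (\<lambda>x. X 1 x ^ (2*m) * X 2 x ^ 2 * X 3 x ^ 2 * X 4 x ^ 2)
           = prob_space.expectation M (\<lambda>x. X 1 x ^ (2*m)) * prob_space.expectation M (\<lambda>x. X 2 x ^ 2)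
             * prob_space.expectation M (\<lambda>x. X 3 x ^ 2) * prob_space.expectation M (\<lambda>x. X 4 x ^ 2)
          \<longleftrightarrow> prob_space.indep_vars M (\<lambda>_. borel) X {1..4})"
proof -
  interpret prob_space M by fact
  have I: "{1..4::nat} = {1, 2, 3, 4}" by auto
  have G: "centered_gaussian M (\<lambda>x. \<Sum>i\<in>{1..4}. t i * X i x)" for t
  proof -
    have "(\<lambda>x. \<Sum>i\<in>{1..4}. t i * X i x) \<in> borel_measurable M"
      using assms(3) unfolding centered_gaussian_vector_def
      by (intro borel_measurable_sum borel_measurable_times) auto
    then show ?thesis
      using assms(3) unfolding centered_gaussian_vector_def centered_gaussian_def by blast
  qed
  have G4: "centered_gaussian M (\<lambda>x. e * X 1 x + (f * X 2 x + g * X 3 x + h * X 4 x))" for e f g h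
    using G[of "\<lambda>i. if i = 1 then e else if i = 2 then f else if i = 3 then g else h"]
    unfolding I by (simp add: add.assoc)
  have Xi: "centered_gaussian M (X i)" if "i \<in> {1..4}" for i
    using that G4[of 1 0 0 0] G4[of 0 1 0 0] G4[of 0 0 1 0] G4[of 0 0 0 1] unfolding I by auto
  \<comment> \<open>The odd moment at index 0 is the mean. It vanishes, so the variance is the
    second moment.\<close>
  have pos: "expectation (\<lambda>x. (X i x)\<^sup>2) > 0" if "i \<in> {1..4}" for i
    using bspec[OF assms(4) that] centered_gaussian_odd_moment[OF Xi[OF that], of 0] by simp
  interpret gaussian_quadruple M "X 1" "X 2" "X 3" "X 4"
    by unfold_locales (use G4 pos in auto)
  have pos234: "expectation (\<lambda>x. (X 2 x)\<^sup>2) > 0" "expectation (\<lambda>x. (X 3 x)\<^sup>2) > 0"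
    "expectation (\<lambda>x. (X 4 x)\<^sup>2) > 0"
    by (intro pos; simp)+
  note gpi = gaussian_product_inequality[OF assms(1) pos234]
  show ?thesis
  proof (intro conjI iffI)
    show "expectation (\<lambda>x. X 1 x ^ (2*m)) * expectation (\<lambda>x. X 2 x ^ 2) * expectation (\<lambda>x. X 3 x ^ 2) * expectation (\<lambda>x. X 4 x ^ 2)
        \<le> expectation (\<lambda>x. X 1 x ^ (2*m) * X 2 x ^ 2 * X 3 x ^ 2 * X 4 x ^ 2)"
      by (rule gpi(1))
  next
    assume "expectation (\<lambda>x. X 1 x ^ (2*m) * X 2 x ^ 2 * X 3 x ^ 2 * X 4 x ^ 2)
        = expectation (\<lambda>x. X 1 x ^ (2*m)) * expectation (\<lambda>x. X 2 x ^ 2) * expectation (\<lambda>x. X 3 x ^ 2) * expectation (\<lambda>x. X 4 x ^ 2)"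
    note unc = gpi(2)[OF this]
    show "indep_vars (\<lambda>_. borel) X {1..4}"
    proof (rule uncorrelated_gaussian_imp_indep_vars[OF _ G])
      fix i j :: nat
      assume "i \<in> {1..4}" "j \<in> {1..4}" "i \<noteq> j"
      then show "expectation (\<lambda>x. X i x * X j x) = 0"
        unfolding I using unc by (auto simp: mult.commute)
    qed simp
  next
    assume ind: "indep_vars (\<lambda>_. borel) X {1..4}"
    \<comment> \<open>Index-dependent exponents turn the left-hand side into a single product over
      the index set, to which the product rule for independent variables applies.\<close>
    define k where "k i = (if i = 1 then 2 * m else 2)" for i :: nat
    have "indep_vars (\<lambda>_. borel) (\<lambda>i x. X i x ^ k i) {1..4}"
      by (rule indep_vars_compose2[OF ind]) auto
    then have "expectation (\<lambda>x. \<Prod>i\<in>{1..4}. X i x ^ k i) = (\<Prod>i\<in>{1..4}. expectation (\<lambda>x. X i x ^ k i))"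
      using Xi centered_gaussian_all_moments
      by (intro indep_vars_lebesgue_integral) (auto simp: all_moments_def)
    then show "expectation (\<lambda>x. X 1 x ^ (2*m) * X 2 x ^ 2 * X 3 x ^ 2 * X 4 x ^ 2)
        = expectation (\<lambda>x. X 1 x ^ (2*m)) * expectation (\<lambda>x. X 2 x ^ 2) * expectation (\<lambda>x. X 3 x ^ 2) * expectation (\<lambda>x. X 4 x ^ 2)"
      unfolding I by (simp add: k_def mult.assoc)
  qed
qed

end
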